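(* Let $\alpha\in(0,1]$ and let $f\in\mathcal{K}_\alpha$, i.e. $f$ is strongly convex of order $\alpha$. Then the second Hankel determinant $H_{2,1}(F_{f^{-1}}/2)=\Gamma_1\Gamma_3-\Gamma_2^2$ of the logarithmic inverse coefficients of $f$ satisfies $$ |H_{2,1}(F_{f^{-1}}/2)|\le \begin{cases} \dfrac{\alpha^2}{36}, & 0<\alpha\le \dfrac13,\\[3mm] \dfrac{\alpha^2(17+18\alpha+13\alpha^2)}{144(4+6\alpha+\alpha^2)}, & \dfrac13<\alpha\le 1. \end{cases} $$ The inequality is sharp: for each $\alpha\in(0,1]$ there is a function $f\in\mathcal{K}_\alpha$ for which equality holds.
   Context: Let $\mathbb{D}=\{z\in\mathbb{C}:|z|<1\}$ and let $\mathcal{A}$ be the class of analytic functions $f$ on $\mathbb{D}$ with $f(0)=0$ and $f'(0)=1$, written $f(z)=z+\sum_{n=2}^\infty a_nz^n$. For $\alpha\in(0,1]$, a function $f\in\mathcal{A}$ is called strongly convex of order $\alpha$ if $$\left|\arg\left(1+\frac{zf''(z)}{f'(z)}\right)\right|<\frac{\pi\alpha}{2}\quad\text{for all } z\in\mathbb{D}$$ (with $f'$ non-vanishing on $\mathbb{D}$, so that the expression is analytic, non-zero, and equal to $1$ at $z=0$; $\arg$ is the principal argument). The set of all such functions is denoted $\mathcal{K}_\alpha$. These functions are univalent in $\mathbb{D}$. For univalent $f\in\mathcal{A}$ let $f^{-1}$ be the inverse function of $f$, defined for $|w|<1/4$. The logarithmic inverse coefficients $\Gamma_n$, $n\ge1$,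 of $f$ are defined by $$F_{f^{-1}}(w):=\log\frac{f^{-1}(w)}{w}=2\sum_{n=1}^\infty\Gamma_nw^n,\qquad |w|<1/4,$$ where the branch of the logarithm is the one vanishing at $w=0$. The second Hankel determinant of $F_{f^{-1}}/2$ is $$H_{2,1}(F_{f^{-1}}/2):=\Gamma_1\Gamma_3-\Gamma_2^2=\frac1{48}\left(13a_2^4-12a_2^2a_3-12a_3^2+12a_2a_4\right).$$ *)

theory Defs
  imports "HOL-Complex_Analysis.Complex_Analysis"
begin

definition class_A :: "(complex \<Rightarrow> complex) set" where
  "class_A = {f. f holomorphic_on ball 0 1 \<and> f 0 = 0 \<and> deriv f 0 = 1}"

text \<open>
  Since \<^term>\<open>Arg 0 = 0\<close> and \<^term>\<open>x / 0 = 0\<close> in the library, the conditions that \<open>f'\<close> and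
  \<open>1 + z f'' / f'\<close> do not vanish are part of the definition.
\<close>

definition strongly_convex :: "real \<Rightarrow> (complex \<Rightarrow> complex) set" where
  "strongly_convex \<alpha> = {f \<in> class_A. \<forall>z\<in>ball 0 1.
     deriv f z \<noteq> 0 \<and>
     1 + z * deriv (deriv f) z / deriv f z \<noteq> 0 \<and>
     \<bar>Arg (1 + z * deriv (deriv f) z / deriv f z)\<bar> < pi * \<alpha> / 2}"

text \<open>
  \<open>F\<close> is the branch of \<open>log (f\<inverse>(w) / w)\<close> on \<open>|w| < 1/4\<close> that vanishes at \<open>0\<close>. The quotient is
  only constrained at \<open>w \<noteq> 0\<close>; its removable singularity at \<open>0\<close> is accounted for by \<open>F\<close> being
  holomorphic on the whole disc. Existence for univalent \<open>f\<close> rests on the Koebe quarter theorem;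
  uniqueness on the disc is proved below.
\<close>

definition is_log_inverse :: "(complex \<Rightarrow> complex) \<Rightarrow> (complex \<Rightarrow> complex) \<Rightarrow> bool" where
  "is_log_inverse f F \<longleftrightarrow>
     F holomorphic_on ball 0 (1/4) \<and> F 0 = 0 \<and>
     (\<forall>w\<in>ball 0 (1/4) - {0}. exp (F w) = inv_into (ball 0 1) f w / w)"

definition log_inverse :: "(complex \<Rightarrow> complex) \<Rightarrow> complex \<Rightarrow> complex" where
  "log_inverse f = (SOME F. is_log_inverse f F)"

lemma is_log_inverse_unique:
  assumes "is_log_inverse f F" "is_log_inverse f G" "w \<in> ball 0 (1/4)"
  shows "F w = G w"
proof -
  let ?B = "ball (0::complex) (1/4)"
  define D where "D = (\<lambda>w. F w - G w)"
  have hol: "F holomorphic_on ?B" "G holomorphic_on ?B"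
    using assms by (auto simp: is_log_inverse_def)
  have D0: "D 0 = 0"
    using assms by (auto simp: is_log_inverse_def D_def)
  have expD: "exp (D v) = 1" if "v \<in> ?B" for v
  proof (cases "v = 0")
    case True
    then show ?thesis by (simp add: D0)
  next
    case False
    then have "exp (F v) = exp (G v)"
      using assms that by (auto simp: is_log_inverse_def)
    then show ?thesis by (simp add: D_def exp_diff)
  qed
  have "(D has_field_derivative 0) (at v)" if "v \<in> ?B" for v
  proof -
    have d: "(D has_field_derivative deriv D v) (at v)"
      unfolding D_def by (rule holomorphic_derivI[of _ ?B]) (use hol that in \<open>auto intro!: holomorphic_intros\<close>)
    then have 1: "((\<lambda>v. exp (D v)) has_field_derivative exp (D v) * deriv D v) (at v)"
      by (auto intro!: derivative_eq_intros)
    have "((\<lambda>v. exp (D v)) has_field_derivative 0) (at v)"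
      by (rule has_field_derivative_transform_within_open[of "\<lambda>_. 1" _ _ ?B])
         (use that expD in auto)
    then have "exp (D v) * deriv D v = 0"
      by (rule DERIV_unique[OF 1])
    with d show ?thesis by simp
  qed
  then have "\<exists>c. \<forall>v\<in>?B. D v = c"
    by (intro has_field_derivative_zero_constant) (auto intro: has_field_derivative_at_within)
  then have "D w = D 0"
    using assms(3) by fastforce
  then show "F w = G w"
    unfolding D0 by (simp add: D_def)
qed

text \<open>The coefficients \<open>\<Gamma>\<^sub>n\<close> in \<open>log (f\<inverse>(w) / w) = 2 (\<Gamma>\<^sub>1 w + \<Gamma>\<^sub>2 w\<^sup>2 + \<dots>)\<close>.\<close>

definition log_inverse_coeff :: "(complex \<Rightarrow> complex) \<Rightarrow> nat \<Rightarrow> complex" where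
  "log_inverse_coeff f n = fps_nth (fps_expansion (log_inverse f) 0) n / 2"

definition hankel_2_1 :: "(nat \<Rightarrow> complex) \<Rightarrow> complex" where
  "hankel_2_1 c = c 1 * c 3 - (c 2)\<^sup>2"

end

theory Submission
  imports Defs
begin

text \<open>
  The number \<open>1 + z f''/f'\<close> lies in the sector \<open>\<bar>arg\<bar> < \<pi>\<alpha>/2\<close> exactly when it equals
  \<open>((1 + \<omega>)/(1 - \<omega>))\<^sup>\<alpha>\<close> for a Schwarz function \<open>\<omega>(z) = c\<^sub>1 z + c\<^sub>2 z\<^sup>2 + \<dots>\<close>, because
  \<open>u \<mapsto> (1 + u)/(1 - u)\<close> maps the disc onto the right half-plane. Comparing Taylor coefficients
  (\<open>hankel_inverse_coeffs\<close>, \<open>hankel_schwarz_coeffs\<close>) turns the Hankel determinant into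
  \<open>\<alpha>\<^sup>2/144\<close> times
  \<open>\<Phi> = (2 + \<alpha>\<^sup>2) c\<^sub>1\<^sup>4 - 6 \<alpha> c\<^sub>1\<^sup>2 c\<^sub>2 - 4 c\<^sub>2\<^sup>2 + 6 c\<^sub>1 c\<^sub>3\<close>.

  By Schur's algorithm (\<open>schur_parameters\<close>), with \<open>s = \<bar>c\<^sub>1\<bar>\<^sup>2\<close> the other coefficients are
  \<open>c\<^sub>2 = (1 - s) y\<close> and \<open>c\<^sub>3 = (1 - s) ((1 - \<bar>y\<bar>\<^sup>2) v - cnj c\<^sub>1 y\<^sup>2)\<close> with \<open>y\<close>, \<open>v\<close> in the closed
  unit disc. After a rotation, \<open>\<Phi>\<close> is \<open>A - B y - K y\<^sup>2\<close> plus a term of modulus at most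
  \<open>D (1 - \<bar>y\<bar>\<^sup>2)\<close>, with nonnegative \<open>A, B, K, D\<close> depending on \<open>s\<close> and \<open>\<alpha>\<close> only. For \<open>y\<close>
  inside the disc the resulting bound is an average of the maximum of \<open>\<bar>A - B y - K y\<^sup>2\<bar>\<close> on the unit
  circle and of a quantity that is at most \<open>4\<close> (\<open>schur_functional_bound\<close>), so the circle decides. There the
  squared modulus is a concave quadratic in \<open>Re y\<close>; either it is largest at \<open>y = 1\<close>, where the
  modulus is that of \<open>K - A + B = 4 + (6\<alpha> - 2) s - (4 + 6\<alpha> + \<alpha>\<^sup>2) s\<^sup>2\<close>, or \<open>s\<close> is so large that the
  interior maximum stays below the bound (\<open>circle_quadratic_bound\<close>). Maximising
  \<open>K - A + B\<close> over \<open>s\<close> gives \<open>4\<close> at \<open>s = 0\<close> when \<open>\<alpha> \<le> 1/3\<close> and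
  \<open>(17 + 18\<alpha> + 13\<alpha>\<^sup>2)/(4 + 6\<alpha> + \<alpha>\<^sup>2)\<close> at \<open>s = (3\<alpha> - 1)/(4 + 6\<alpha> + \<alpha>\<^sup>2)\<close> otherwise. Equality holds for
  \<open>\<omega>(z) = z (z + c)/(1 + c z)\<close> with \<open>c\<^sup>2 = s\<close>, the Schwarz function with \<open>c\<^sub>1 = c\<close> and \<open>y = 1\<close>.

  The logarithmic inverse coefficients only make sense once \<open>f\<close> is known to be injective on the
  disc with an image containing \<open>\<bar>w\<bar> < 1/4\<close>. For convex functions both facts have short proofs.
  The tangent of \<open>\<theta> \<mapsto> f(r e\<^sup>i\<^sup>\<theta>)\<close> turns monotonically through a total angle \<open>2\<pi>\<close>, so \<open>f\<close> is
  injective on each circle (\<open>convex_inj_circle\<close>); a pair of points with equal values and least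
  maximal modulus would lie on one circle (\<open>inj_on_ball_if_inj_on_circles\<close>). Moreover
  \<open>\<bar>f'\<bar> \<ge> 1/4\<close>, so the inverse function expands distances at most by the factor \<open>4\<close> and cannot
  reach the boundary of the disc before \<open>\<bar>w\<bar> = 1/4\<close> (\<open>ball_subset_image_if_deriv_bound\<close>).
\<close>

section \<open>Univalence and covering for convex functions\<close>

text \<open>
  The inverse of the Cayley transform \<open>u \<mapsto> (1 + u)/(1 - u)\<close> maps the right half-plane to the disc.
\<close>

lemma schwarz_of_halfplane:
  assumes hol: "P holomorphic_on ball 0 1" and pos: "\<And>z. z \<in> ball 0 1 \<Longrightarrow> 0 < Re (P z)" and P0: "P 0 = 1"
  obtains \<omega> where "\<omega> holomorphic_on ball 0 1" "\<And>z. z \<in> ball 0 1 \<Longrightarrow> cmod (\<omega> z) < 1" "\<omega> 0 = 0"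
    "\<And>z. z \<in> ball 0 1 \<Longrightarrow> P z = (1 + \<omega> z) / (1 - \<omega> z)"
proof (rule that[of "\<lambda>z. (P z - 1) / (P z + 1)"])
  have ne: "P z + 1 \<noteq> 0" if "z \<in> ball 0 1" for z
    using pos[OF that] by (auto simp: complex_eq_iff)
  show "(\<lambda>z. (P z - 1) / (P z + 1)) holomorphic_on ball 0 1"
    using hol ne by (intro holomorphic_intros) auto
  show "(P 0 - 1) / (P 0 + 1) = 0" using P0 by simp
  fix z :: complex assume z: "z \<in> ball 0 1"
  have "(cmod (P z - 1))\<^sup>2 < (cmod (P z + 1))\<^sup>2"
    unfolding cmod_power2 using pos[OF z] by (simp add: power2_eq_square algebra_simps)
  then have "cmod (P z - 1) < cmod (P z + 1)" by (rule power_less_imp_less_base) simp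
  then show "cmod ((P z - 1) / (P z + 1)) < 1"
    using ne[OF z] by (simp add: norm_divide divide_less_eq)
  show "P z = (1 + (P z - 1) / (P z + 1)) / (1 - (P z - 1) / (P z + 1))"
  proof -
    have "1 + (P z - 1) / (P z + 1) = 2 * P z / (P z + 1)" "1 - (P z - 1) / (P z + 1) = 2 / (P z + 1)"
      using ne[OF z] by (simp_all add: field_simps)
    then show ?thesis using ne[OF z] by simp
  qed
qed

lemma Re_cayley_pos:
  assumes "cmod u < 1"
  shows "0 < Re ((1 + u) / (1 - u))"
proof -
  have "(1 + u) / (1 - u) = (1 + u) * cnj (1 - u) / (cmod (1 - u))\<^sup>2"
    by (rule complex_div_cnj)
  also have "Re \<dots> = Re ((1 + u) * cnj (1 - u)) / (cmod (1 - u))\<^sup>2"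
    by (simp only: Re_divide_of_real of_real_power[symmetric])
  also have "Re ((1 + u) * cnj (1 - u)) = 1 - (cmod u)\<^sup>2"
    unfolding cmod_power2 by (simp add: power2_eq_square algebra_simps)
  also have "0 < (1 - (cmod u)\<^sup>2) / (cmod (1 - u))\<^sup>2"
    using assms by (intro divide_pos_pos) (auto simp: power_less_one_iff)
  finally show ?thesis .
qed

lemma DERIV_Re_compose:
  assumes "(g has_field_derivative d) (at (p t))" "(p has_vector_derivative v) (at t)"
  shows "((\<lambda>t. Re (g (p t))) has_real_derivative Re (d * v)) (at t)"
  using bounded_linear.has_vector_derivative[OF bounded_linear_Re field_vector_diff_chain_at[OF assms(2,1)]]
  by (simp add: o_def has_real_derivative_iff_has_vector_derivative mult.commute)

lemma has_vector_derivative_circle: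
  "((\<lambda>t. of_real r * cis t) has_vector_derivative \<i> * (of_real r * cis t)) (at t)"
proof -
  have "(cis has_vector_derivative \<i> * cis t) (at t)"
    using has_derivative_cis[OF has_derivative_ident, of t UNIV]
    by (simp add: has_vector_derivative_def scaleR_conv_of_real mult_ac)
  from has_vector_derivative_mult_right[OF this, of "of_real r"] show ?thesis
    by (simp add: mult_ac)
qed

text \<open>
  With \<open>L = log f'\<close>, the tangent vector \<open>i z f'(z)\<close> of the image of the circle has argument
  \<open>\<tau> + \<pi>/2\<close>, and convexity says precisely that \<open>\<tau>\<close> is increasing. If \<open>\<tau>\<close> grows by at most \<open>\<pi>\<close> along the
  arc, then all tangent vectors lie in one half-plane and the arc cannot close up.
\<close>

lemma arc_endpoints_distinct:
  fixes f L :: "complex \<Rightarrow> complex" and r a b :: real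
  defines "\<gamma> \<equiv> \<lambda>t. of_real r * cis t"
  defines "\<tau> \<equiv> \<lambda>t. t + Im (L (\<gamma> t))"
  assumes r: "0 < r" "r < 1"
    and L: "L holomorphic_on ball 0 1"
    and f: "\<And>z. z \<in> ball 0 1 \<Longrightarrow> (f has_field_derivative exp (L z)) (at z)"
    and convex: "\<And>z. z \<in> ball 0 1 \<Longrightarrow> 0 < Re (1 + z * deriv L z)"
    and ab: "a < b" "\<tau> b - \<tau> a \<le> pi"
  shows "f (\<gamma> a) \<noteq> f (\<gamma> b)"
proof -
  have \<gamma>: "\<gamma> t \<in> ball 0 1" for t using r by (simp add: \<gamma>_def norm_mult)
  have d\<gamma>: "(\<gamma> has_vector_derivative \<i> * \<gamma> t) (at t)" for t
    unfolding \<gamma>_def by (rule has_vector_derivative_circle)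
  have d\<tau>: "(\<tau> has_real_derivative Re (1 + \<gamma> t * deriv L (\<gamma> t))) (at t)" for t
  proof -
    have "((\<lambda>t. t + Re ((\<lambda>z. - \<i> * L z) (\<gamma> t))) has_real_derivative
        1 + Re (- \<i> * deriv L (\<gamma> t) * (\<i> * \<gamma> t))) (at t)"
      by (intro DERIV_add DERIV_ident DERIV_Re_compose DERIV_cmult holomorphic_derivI[OF L] \<gamma> d\<gamma>) auto
    then show ?thesis by (simp add: \<tau>_def mult_ac algebra_simps)
  qed
  have mono: "\<tau> s < \<tau> t" if "s < t" for s t
    using that by (rule DERIV_pos_imp_increasing) (use d\<tau> convex[OF \<gamma>] in blast)
  define m where "m = (\<tau> a + \<tau> b) / 2"
  \<comment> \<open>The component of the curve in the mean tangent direction \<open>cis (m + \<pi>/2)\<close>, which increases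
    along the arc.\<close>
  define h where "h = (\<lambda>t. Re (cis (- m) * (- \<i>) * f (\<gamma> t)))"
  have dh: "(h has_real_derivative r * exp (Re (L (\<gamma> t))) * cos (\<tau> t - m)) (at t)" for t
  proof -
    have "(h has_real_derivative Re ((cis (- m) * (- \<i>)) * exp (L (\<gamma> t)) * (\<i> * \<gamma> t))) (at t)"
      unfolding h_def by (intro DERIV_Re_compose[where g = "\<lambda>z. cis (- m) * (- \<i>) * f z"] DERIV_cmult f \<gamma> d\<gamma>)
    also have "(cis (- m) * (- \<i>)) * exp (L (\<gamma> t)) * (\<i> * \<gamma> t) = r * exp (Re (L (\<gamma> t))) * cis (\<tau> t - m)"
    proof -
      have "cis (\<tau> t - m) = cis (- m) * (cis t * cis (Im (L (\<gamma> t))))"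
        by (simp add: \<tau>_def cis_mult algebra_simps)
      moreover have "exp (L (\<gamma> t)) = exp (Re (L (\<gamma> t))) * cis (Im (L (\<gamma> t)))"
        by (simp add: exp_eq_polar)
      ultimately show ?thesis by (simp add: \<gamma>_def mult_ac)
    qed
    finally show ?thesis by simp
  qed
  have "h a < h b"
  proof (rule DERIV_pos_imp_increasing_open[OF ab(1)])
    fix t assume t: "a < t" "t < b"
    have "\<tau> t - m < pi/2" using mono[OF t(2)] ab(2) unfolding m_def by argo
    moreover have "-(pi/2) < \<tau> t - m" using mono[OF t(1)] ab(2) unfolding m_def by argo
    ultimately have "0 < cos (\<tau> t - m)" by (intro cos_gt_zero_pi)
    then show "\<exists>y. DERIV h t :> y \<and> y > 0" using dh[of t] r by auto
  next
    show "continuous_on {a..b} h"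
      using dh by (meson DERIV_isCont continuous_at_imp_continuous_on)
  qed
  then show ?thesis by (auto simp: h_def)
qed

text \<open>
  Two points split the circle into two arcs. As \<open>\<tau>\<close> grows by \<open>2\<pi>\<close> in total, it grows by at
  most \<open>\<pi>\<close> on one of them.
\<close>

lemma convex_inj_circle:
  fixes f L :: "complex \<Rightarrow> complex"
  assumes L: "L holomorphic_on ball 0 1"
    and f: "\<And>z. z \<in> ball 0 1 \<Longrightarrow> (f has_field_derivative exp (L z)) (at z)"
    and convex: "\<And>z. z \<in> ball 0 1 \<Longrightarrow> 0 < Re (1 + z * deriv L z)"
    and zw: "z \<in> ball 0 1" "cmod w = cmod z" "z \<noteq> w"
  shows "f z \<noteq> f w"
proof -
  define r where "r = cmod z"
  define \<gamma> where "\<gamma> = (\<lambda>t. of_real r * cis t)"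
  define \<tau> where "\<tau> = (\<lambda>t. t + Im (L (\<gamma> t)))"
  have r: "0 < r" "r < 1" using zw by (auto simp: r_def)
  have per: "\<gamma> (t + 2*pi) = \<gamma> t" for t by (simp add: \<gamma>_def flip: cis_mult)
  have main: "f (\<gamma> a) \<noteq> f (\<gamma> b)" if "a < b" "b < a + 2*pi" for a b
  proof (cases "\<tau> b - \<tau> a \<le> pi")
    case True
    then show ?thesis
      using arc_endpoints_distinct[OF r L f convex \<open>a < b\<close>] by (simp add: \<gamma>_def \<tau>_def)
  next
    case False
    have "\<tau> (a + 2*pi) = \<tau> a + 2*pi" by (simp add: \<tau>_def per)
    with False have "\<tau> (a + 2*pi) - \<tau> b \<le> pi" by simp
    then have "f (\<gamma> b) \<noteq> f (\<gamma> (a + 2*pi))"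
      using arc_endpoints_distinct[OF r L f convex \<open>b < a + 2*pi\<close>] by (simp add: \<gamma>_def \<tau>_def)
    then show ?thesis by (simp add: per)
  qed
  have z: "z = \<gamma> (Arg z)" and w: "w = \<gamma> (Arg w)"
    using zw(2) rcis_cmod_Arg[of z] rcis_cmod_Arg[of w] by (simp_all add: \<gamma>_def r_def rcis_def)
  have "Arg z \<noteq> Arg w" using z w zw(3) by metis
  moreover have "\<bar>Arg z - Arg w\<bar> < 2*pi"
    using mpi_less_Arg[of z] mpi_less_Arg[of w] Arg_le_pi[of z] Arg_le_pi[of w] by linarith
  ultimately have "f (\<gamma> (Arg z)) \<noteq> f (\<gamma> (Arg w))"
    using main[of "Arg z" "Arg w"] main[of "Arg w" "Arg z"] by (cases "Arg z < Arg w") auto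
  then show ?thesis using z w by metis
qed

text \<open>
  Among all pairs of distinct points with equal values choose one with the least larger
  modulus; local injectivity keeps the two points apart, so compactness provides a minimum. If the
  moduli differed, the outer point could be moved inwards while, by the open mapping theorem, the
  inner one follows, and the pair would not be minimal. So both points lie on one circle.
\<close>

lemma inj_on_ball_if_inj_on_circles:
  fixes f :: "complex \<Rightarrow> complex"
  assumes hol: "f holomorphic_on ball 0 R" and d: "\<And>z. z \<in> ball 0 R \<Longrightarrow> deriv f z \<noteq> 0"
    and circle: "\<And>z w. z \<in> ball 0 R \<Longrightarrow> cmod w = cmod z \<Longrightarrow> z \<noteq> w \<Longrightarrow> f z \<noteq> f w"
  shows "inj_on f (ball 0 R)"
proof (rule ccontr)
  assume "\<not> inj_on f (ball 0 R)"
  then obtain z1 z2 where z12: "z1 \<in> ball 0 R" "z2 \<in> ball 0 R" "z1 \<noteq> z2" "f z1 = f z2"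
    by (auto simp: inj_on_def)
  define r where "r = max (cmod z1) (cmod z2)"
  have r: "r < R" using z12 by (auto simp: r_def)
  have cont: "continuous_on (ball 0 R) f" using hol by (rule holomorphic_on_imp_continuous_on)
  \<comment> \<open>By local injectivity \<open>\<Union>U\<close> is an open set that contains the diagonal but no pair of distinct points
    with equal values. Removing it from \<open>E\<close> leaves exactly those pairs, and a compact set.\<close>
  define U where "U = {V \<times> V |V. open V \<and> inj_on f V}"
  define E where "E = {p \<in> cball 0 r \<times> cball 0 r. f (fst p) - f (snd p) = 0}"
  define S where "S = E - \<Union>U"
  have sub: "cball 0 r \<subseteq> ball (0::complex) R" using r by auto
  have "closed E" unfolding E_def
    by (intro continuous_closed_preimage_constant continuous_intros closed_Times
        continuous_on_compose2[OF cont]) (use sub in auto)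
  moreover have "bounded E"
    by (rule bounded_subset[of "cball 0 r \<times> cball 0 r"]) (auto simp: E_def intro: bounded_Times)
  ultimately have "compact E" by (simp add: compact_eq_bounded_closed)
  moreover have "open (\<Union>U)" by (auto simp: U_def intro: open_Times)
  ultimately have "compact S" unfolding S_def by (rule compact_diff)
  have memS: "(z, w) \<in> S" if "cmod z \<le> r" "cmod w \<le> r" "z \<noteq> w" "f z = f w" for z w
    using that by (auto simp: S_def E_def U_def inj_on_def)
  have S_D: "cmod z \<le> r \<and> cmod w \<le> r \<and> z \<noteq> w \<and> f z = f w" if "(z, w) \<in> S" for z w
  proof -
    have "z \<noteq> w"
    proof
      assume "z = w"
      have "z \<in> ball 0 R" using that sub by (auto simp: S_def E_def)
      then obtain e where "e > 0" "inj_on f (ball z e)"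
        using has_complex_derivative_locally_injective[OF hol _ open_ball d] by blast
      then have "ball z e \<times> ball z e \<in> U" unfolding U_def by blast
      moreover have "(z, w) \<in> ball z e \<times> ball z e" using \<open>z = w\<close> \<open>e > 0\<close> by simp
      ultimately show False using that unfolding S_def by blast
    qed
    then show ?thesis using that by (auto simp: S_def E_def)
  qed
  have "(z1, z2) \<in> S" using z12 by (intro memS) (auto simp: r_def)
  then have "S \<noteq> {}" by blast
  define \<mu> where "\<mu> = (\<lambda>p::complex \<times> complex. max (cmod (fst p)) (cmod (snd p)))"
  have "continuous_on S \<mu>" unfolding \<mu>_def by (intro continuous_intros)
  from continuous_attains_inf[OF \<open>compact S\<close> \<open>S \<noteq> {}\<close> this]
  obtain p where p: "p \<in> S" "\<And>q. q \<in> S \<Longrightarrow> \<mu> p \<le> \<mu> q" by blast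
  define z where "z = (if cmod (fst p) \<le> cmod (snd p) then fst p else snd p)"
  define w where "w = (if cmod (fst p) \<le> cmod (snd p) then snd p else fst p)"
  have zw: "cmod z \<le> cmod w" "cmod w \<le> r" "z \<noteq> w" "f z = f w" "\<mu> p = cmod w"
    using S_D[of "fst p" "snd p"] p(1) by (auto simp: z_def w_def \<mu>_def)
  have min: "cmod w \<le> max (cmod z') (cmod w')"
    if "cmod z' \<le> r" "cmod w' \<le> r" "z' \<noteq> w'" "f z' = f w'" for z' w'
    using p(2)[OF memS[OF that]] zw(5) by (simp only: \<mu>_def fst_conv snd_conv)
  have wR: "w \<in> ball 0 R" "z \<in> ball 0 R" using zw r by auto
  have "cmod z \<noteq> cmod w" using circle[OF wR(1), of z] zw by auto
  then have lt: "cmod z < cmod w" using zw by simp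
  define e where "e = min (cmod w - cmod z) (dist z w / 2)"
  have e: "0 < e" using lt zw(3) by (simp add: e_def)
  have ball_e: "cmod z' < cmod w" if "z' \<in> ball z e" for z'
    using that norm_triangle_ineq2[of z' z] by (auto simp: e_def dist_norm norm_minus_commute)
  obtain V where V: "open V" "z \<in> V" "V \<subseteq> ball z e" "open (f ` V)"
  proof -
    obtain k where k: "k > 0" "ball z k \<subseteq> ball 0 R" "inj_on f (ball z k)"
      using has_complex_derivative_locally_injective[OF hol wR(2) open_ball d[OF wR(2)]] by blast
    have "open (f ` (ball z (min k e)))"
      using k hol by (intro open_mapping_thm3) (auto elim!: holomorphic_on_subset inj_on_subset)
    moreover have "ball z (min k e) \<subseteq> ball z e" by (simp add: subset_ball)
    ultimately show thesis using that[of "ball z (min k e)"] k e by simp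
  qed
  have "isCont f w"
    using cont wR(1) by (simp add: continuous_on_eq_continuous_at)
  moreover have "((\<lambda>t. of_real t * w) \<longlongrightarrow> of_real 1 * w) (at_left (1::real))"
    by (intro tendsto_intros)
  ultimately have lim: "((\<lambda>t. f (of_real t * w)) \<longlongrightarrow> f w) (at_left (1::real))"
    by (intro isCont_tendsto_compose[of w f]) auto
  have "eventually (\<lambda>t. f (of_real t * w) \<in> f ` V) (at_left (1::real))"
    using V(2,4) imageI[of z V f] unfolding zw(4) by (intro topological_tendstoD[OF lim])
  moreover have "eventually (\<lambda>t. of_real t * w \<in> ball w (dist z w / 2)) (at_left (1::real))"
    using zw(3) by (intro topological_tendstoD[OF \<open>((\<lambda>t. of_real t * w) \<longlongrightarrow> of_real 1 * w) _\<close>]) auto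
  moreover have "eventually (\<lambda>t. 0 < t \<and> t < 1) (at_left (1::real))"
    using eventually_at_left_real[OF zero_less_one] by eventually_elim auto
  ultimately have "eventually (\<lambda>t. False) (at_left (1::real))"
  proof eventually_elim
    case (elim t)
    then obtain z' where z': "z' \<in> V" "f z' = f (of_real t * w)" by auto
    have "cmod (of_real t * w) < cmod w"
      using elim lt by (auto simp: norm_mult intro!: mult_strict_right_mono[of t 1, simplified] order_le_less_trans[OF norm_ge_zero lt])
    moreover have "cmod z' < cmod w" using z' V ball_e by auto
    moreover have "z' \<noteq> of_real t * w"
    proof
      assume "z' = of_real t * w"
      then have "dist z z' < dist z w / 2" "dist w z' < dist z w / 2"
        using z' V elim by (auto simp: e_def)
      then show False using dist_triangle[of z w z'] by (simp add: dist_commute)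
    qed
    ultimately show False using min[of z' "of_real t * w"] z'(2) zw(2) by auto
  qed
  then show False by (simp add: trivial_limit_at_left_real)
qed

text \<open>
  On the largest centred disc inside the image, of radius \<open>R < q\<close> say, the inverse function has
  Lipschitz constant \<open>1/q\<close>. Its values therefore lie in the compact disc of radius \<open>R/q < 1\<close>, whose image
  is closed and contains the boundary point that should have been omitted.
\<close>

lemma ball_subset_image_if_deriv_bound:
  fixes f :: "complex \<Rightarrow> complex"
  assumes hol: "f holomorphic_on ball 0 1" and inj: "inj_on f (ball 0 1)" and f0: "f 0 = 0"
    and q: "0 < q" "\<And>z. z \<in> ball 0 1 \<Longrightarrow> q \<le> cmod (deriv f z)"
  shows "ball 0 q \<subseteq> f ` ball 0 1"
proof (rule ccontr)
  let ?T = "f ` ball 0 1"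
  assume "\<not> ball 0 q \<subseteq> ?T"
  then obtain w0 where "w0 \<in> ball 0 q" "w0 \<notin> ?T" by blast
  then have w0: "cmod w0 < q" "w0 \<notin> ?T" by auto
  have T: "open ?T" by (rule open_mapping_thm3[OF hol open_ball inj])
  obtain w where w: "w \<in> - ?T" "\<And>y. y \<in> - ?T \<Longrightarrow> dist 0 w \<le> dist 0 y"
    using distance_attains_inf[of "- ?T" 0] T w0 by blast
  define R where "R = cmod w"
  have "R < q" using w(2)[of w0] w0 by (simp add: R_def)
  have "0 \<in> ?T" using f0 by force
  then have "0 < R" using w(1) by (auto simp: R_def)
  have sub: "ball 0 R \<subseteq> ?T" using w(2) by (force simp: R_def)
  obtain g where g: "g holomorphic_on ?T" "\<And>z. z \<in> ball 0 1 \<Longrightarrow> deriv f z * deriv g (f z) = 1"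
     "\<And>z. z \<in> ball 0 1 \<Longrightarrow> g (f z) = z"
    using holomorphic_has_inverse[OF hol open_ball inj] by blast
  have "cmod (g y) \<le> R / q" if y: "y \<in> ball 0 R" for y
  proof -
    have "cmod (g y - g 0) \<le> (1/q) * cmod (y - 0)"
    proof (rule field_differentiable_bound[of "ball 0 R" g "deriv g"])
      fix x :: complex assume x: "x \<in> ball 0 R"
      then obtain z where z: "z \<in> ball 0 1" "x = f z" using sub by blast
      show "(g has_field_derivative deriv g x) (at x within ball 0 R)"
        using x sub by (intro holomorphic_derivI[OF g(1) T]) auto
      have "cmod (deriv f z) * cmod (deriv g x) = 1" using g(2)[OF z(1)] z(2) by (metis norm_mult norm_one)
      moreover have "q * cmod (deriv g x) \<le> cmod (deriv f z) * cmod (deriv g x)"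
        using q(2)[OF z(1)] by (intro mult_right_mono) auto
      ultimately show "cmod (deriv g x) \<le> 1/q" using q(1) by (simp add: field_simps)
    qed (use y \<open>0 < R\<close> in auto)
    moreover have "g 0 = 0" using g(3)[of 0] f0 by simp
    moreover have "(1/q) * cmod y \<le> R / q" using y q(1) by (simp add: field_simps)
    ultimately show ?thesis by simp
  qed
  then have "ball 0 R \<subseteq> f ` cball 0 (R/q)"
  proof (intro subsetI)
    fix y :: complex assume y: "y \<in> ball 0 R" and *: "\<And>y. y \<in> ball 0 R \<Longrightarrow> cmod (g y) \<le> R / q"
    then obtain z where "z \<in> ball 0 1" "y = f z" using sub by blast
    then show "y \<in> f ` cball 0 (R/q)" using *[OF y] g(3)[of z] by (intro image_eqI[of _ _ z]) auto
  qed
  moreover have cb: "cball 0 (R/q) \<subseteq> ball (0::complex) 1"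
  proof -
    have "R/q < 1" using \<open>R < q\<close> q(1) by simp
    then show ?thesis by auto
  qed
  have "compact (f ` cball 0 (R/q))"
    using cb hol by (intro compact_continuous_image) (auto intro: holomorphic_on_imp_continuous_on continuous_on_subset)
  ultimately have "closure (ball 0 R) \<subseteq> f ` cball 0 (R/q)"
    by (intro closure_minimal compact_imp_closed)
  then have "w \<in> f ` cball 0 (R/q)" using \<open>0 < R\<close> by (auto simp: R_def)
  then show False using w(1) cb by auto
qed

text \<open>
  The Schwarz lemma gives \<open>Re (1 + z L') \<ge> (1 - r)/(1 + r)\<close> for \<open>\<bar>z\<bar> = r\<close>, that is
  \<open>Re (z L') \<ge> - 2r/(1 + r)\<close>. Integration along a ray yields \<open>\<bar>f'(z)\<bar> = exp (Re L) \<ge> (1 + r)\<^sup>-\<^sup>2\<close>, where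
  \<open>f' = exp L\<close>.
\<close>

lemma convex_deriv_lower_bound:
  fixes L :: "complex \<Rightarrow> complex"
  assumes L: "L holomorphic_on ball 0 1" and L0: "Re (L 0) = 0"
    and convex: "\<And>z. z \<in> ball 0 1 \<Longrightarrow> 0 < Re (1 + z * deriv L z)"
    and z: "z \<in> ball 0 1"
  shows "1/4 \<le> cmod (exp (L z))"
proof -
  have hol: "(\<lambda>z. 1 + z * deriv L z) holomorphic_on ball 0 1"
    using L by (intro holomorphic_intros) auto
  obtain \<omega> where \<omega>: "\<omega> holomorphic_on ball 0 1" "\<And>z. z \<in> ball 0 1 \<Longrightarrow> cmod (\<omega> z) < 1" "\<omega> 0 = 0"
    "\<And>z. z \<in> ball 0 1 \<Longrightarrow> 1 + z * deriv L z = (1 + \<omega> z) / (1 - \<omega> z)"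
    using schwarz_of_halfplane[OF hol convex] by (metis add.right_neutral mult_zero_left)
  have Re_ge: "- 2 * cmod x / (1 + cmod x) \<le> Re (x * deriv L x)" if x: "x \<in> ball 0 1" for x
  proof -
    define u r where "u = \<omega> x" and "r = cmod x"
    have u: "cmod u \<le> r" using Schwarz_Lemma(1)[OF \<omega>(1,3), of x] \<omega>(2) x by (auto simp: u_def r_def)
    have r: "0 \<le> r" "r < 1" using x by (auto simp: r_def)
    have ne: "1 - u \<noteq> 0" using u r by auto
    have "Re (1 + x * deriv L x) = Re ((1 + u) / (1 - u))"
      using \<omega>(4)[OF x] by (simp only: u_def)
    then have "1 + Re (x * deriv L x) = Re ((1 + u) / (1 - u))"
      by (simp only: plus_complex.simps one_complex.simps)
    also have "\<dots> = (1 - (cmod u)\<^sup>2) / (cmod (1 - u))\<^sup>2"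
      unfolding Re_divide cmod_power2 by (simp add: power2_eq_square algebra_simps)
    finally have 1: "1 + Re (x * deriv L x) = (1 - (cmod u)\<^sup>2) / (cmod (1 - u))\<^sup>2" .
    have cu: "0 < 1 + cmod u" by (simp add: add_pos_nonneg)
    have "(1 - r) / (1 + r) \<le> (1 - cmod u) / (1 + cmod u)"
      using u r cu by (simp add: field_simps)
    also have "\<dots> = (1 - (cmod u)\<^sup>2) / (1 + cmod u)\<^sup>2"
      using cu by (simp add: divide_simps) algebra
    also have "\<dots> \<le> (1 - (cmod u)\<^sup>2) / (cmod (1 - u))\<^sup>2"
    proof (rule divide_left_mono)
      show "(cmod (1 - u))\<^sup>2 \<le> (1 + cmod u)\<^sup>2"
        using norm_triangle_ineq4[of 1 u] by (intro power_mono) auto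
      show "0 \<le> 1 - (cmod u)\<^sup>2" using u r by (simp add: power_le_one)
      show "0 < (1 + cmod u)\<^sup>2 * (cmod (1 - u))\<^sup>2"
        using ne cu by (intro mult_pos_pos zero_less_power) auto
    qed
    finally have "(1 - r) / (1 + r) - 1 \<le> Re (x * deriv L x)" using 1 by simp
    moreover have "(1 - r) / (1 + r) - 1 = - 2 * r / (1 + r)" using r by (simp add: field_simps)
    ultimately show ?thesis by (simp add: r_def)
  qed
  define r where "r = cmod z"
  show ?thesis
  proof (cases "r = 0")
    case True
    then show ?thesis using L0 by (simp add: r_def)
  next
    case False
    have r: "0 < r" "r < 1" using False z by (auto simp: r_def)
    define \<zeta> where "\<zeta> = z / r"
    have \<zeta>: "cmod \<zeta> = 1" using False by (simp add: \<zeta>_def r_def norm_divide)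
    define k where "k = (\<lambda>t. Re (L (of_real t * \<zeta>)) + 2 * ln (1 + t))"
    have dk: "(k has_real_derivative Re (deriv L (of_real t * \<zeta>) * \<zeta>) + 2 / (1 + t)) (at t)"
      if t: "0 \<le> t" "t \<le> r" for t
    proof -
      have "((\<lambda>t. of_real t * \<zeta>) has_vector_derivative \<zeta>) (at t)"
        by (rule has_vector_derivative_eq_rhs) (auto intro!: derivative_eq_intros)
      moreover have "(L has_field_derivative deriv L (of_real t * \<zeta>)) (at (of_real t * \<zeta>))"
        using t r \<zeta> by (intro holomorphic_derivI[OF L]) (auto simp: norm_mult)
      ultimately have "((\<lambda>t. Re (L (of_real t * \<zeta>))) has_real_derivative Re (deriv L (of_real t * \<zeta>) * \<zeta>)) (at t)"
        by (rule DERIV_Re_compose[rotated])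
      moreover have "((\<lambda>t. 2 * ln (1 + t)) has_real_derivative 2 / (1 + t)) (at t)"
        using t by (auto intro!: derivative_eq_intros)
      ultimately show ?thesis unfolding k_def by (rule DERIV_add)
    qed
    have "continuous_on {0..r} k"
      using dk by (intro DERIV_atLeastAtMost_imp_continuous_on) blast
    moreover have "k differentiable (at t)" if "0 < t" "t < r" for t
      using dk[of t] that by (auto simp: real_differentiable_def)
    ultimately obtain l t where t: "0 < t" "t < r" "DERIV k t :> l" "k r - k 0 = (r - 0) * l"
      using MVT[OF r(1)] by blast
    have l: "l = Re (deriv L (of_real t * \<zeta>) * \<zeta>) + 2 / (1 + t)"
      using t dk[of t] by (intro DERIV_unique) auto
    have "- 2 * t / (1 + t) \<le> t * Re (deriv L (of_real t * \<zeta>) * \<zeta>)"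
      using Re_ge[of "of_real t * \<zeta>"] t r \<zeta> by (simp add: norm_mult algebra_simps)
    then have "0 \<le> t * l" using t by (simp add: l distrib_left)
    then have "0 \<le> l" using t by (simp add: zero_le_mult_iff)
    then have "k 0 \<le> k r" using t r by (metis diff_ge_0_iff_ge diff_zero mult_nonneg_nonneg less_imp_le)
    moreover have "k 0 = 0" using L0 by (simp add: k_def)
    moreover have "of_real r * \<zeta> = z" using False by (simp add: \<zeta>_def)
    ultimately have "- 2 * ln (1 + r) \<le> Re (L z)" by (simp add: k_def)
    moreover have "ln (1 + r) \<le> ln 2" using r by simp
    ultimately have "- (ln 2 + ln 2) \<le> Re (L z)" by linarith
    have "(1/4::real) = exp (- (ln 2 + ln 2))"
      by (simp only: exp_minus exp_add exp_ln zero_less_numeral) simp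
    also have "\<dots> \<le> exp (Re (L z))" using \<open>- (ln 2 + ln 2) \<le> Re (L z)\<close> by (simp only: exp_le_cancel_iff)
    finally show ?thesis by simp
  qed
qed

text \<open>
  The inverse function is \<open>w h(w)\<close> with \<open>h\<close> zero-free and \<open>h(0) = 1\<close>, so \<open>h\<close> has a logarithm that
  vanishes at \<open>0\<close>.
\<close>

lemma is_log_inverse_exists:
  assumes hol: "f holomorphic_on ball 0 1" and inj: "inj_on f (ball 0 1)" and f0: "f 0 = 0" "deriv f 0 = 1"
    and cover: "ball 0 (1/4) \<subseteq> f ` ball 0 1"
  shows "\<exists>F. is_log_inverse f F"
proof -
  obtain g where g: "g holomorphic_on f ` ball 0 1" "\<And>z. z \<in> ball 0 1 \<Longrightarrow> deriv f z * deriv g (f z) = 1"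
     "\<And>z. z \<in> ball 0 1 \<Longrightarrow> g (f z) = z"
    using holomorphic_has_inverse[OF hol open_ball inj] by blast
  have inv: "f (g w) = w" "inv_into (ball 0 1) f w = g w" if w: "w \<in> ball 0 (1/4)" for w
  proof -
    obtain z where z: "z \<in> ball 0 1" "w = f z" using w cover by blast
    then show "f (g w) = w" "inv_into (ball 0 1) f w = g w" using g(3) inj by (auto simp: inv_into_f_f)
  qed
  have g0: "g 0 = 0" "deriv g 0 = 1" using g(2)[of 0] g(3)[of 0] f0 by auto
  have gh: "g holomorphic_on ball 0 (1/4)" using g(1) cover by (rule holomorphic_on_subset)
  obtain h where h: "h holomorphic_on ball 0 (1/4)" "\<And>w. cmod w < 1/4 \<Longrightarrow> g w = w * h w" "deriv g 0 = h 0"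
    using Schwarz3[OF gh g0(1)] by blast
  have "h w \<noteq> 0" if w: "w \<in> ball 0 (1/4)" for w
  proof (cases "w = 0")
    case True then show ?thesis using h(3) g0 by simp
  next
    case False
    then show ?thesis using inv(1)[OF w] h(2)[of w] w f0 by auto
  qed
  then obtain G where G: "G holomorphic_on ball 0 (1/4)" "\<And>w. w \<in> ball 0 (1/4) \<Longrightarrow> exp (G w) = h w"
    using holomorphic_logarithm_exists[OF convex_ball open_ball h(1), of 0] by auto
  have "is_log_inverse f (\<lambda>w. G w - G 0)"
    unfolding is_log_inverse_def
  proof (intro conjI ballI)
    show "(\<lambda>w. G w - G 0) holomorphic_on ball 0 (1/4)" using G(1) by (intro holomorphic_intros)
    fix w :: complex assume w: "w \<in> ball 0 (1/4) - {0}"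
    have "exp (G 0) = 1" using G(2)[of 0] h(3) g0 by simp
    then have "exp (G w - G 0) = h w" using G(2)[of w] w by (simp add: exp_diff)
    then show "exp (G w - G 0) = inv_into (ball 0 1) f w / w"
      using w inv(2)[of w] h(2)[of w] by simp
  qed simp
  then show ?thesis by blast
qed

section \<open>Schur parameters of a Schwarz function\<close>

text \<open>
  The function \<open>\<psi>\<close> is \<open>(\<phi> - \<phi>(0)) / (z (1 - cnj \<phi>(0) \<phi>))\<close>, which is bounded by \<open>1\<close> by the Schwarz
  lemma. The equation is written without division so that it also covers a constant \<open>\<phi>\<close> of modulus
  \<open>1\<close>, where \<open>\<psi> = 0\<close> is admissible.
\<close>

lemma schur_step:
  assumes hol: "\<phi> holomorphic_on ball 0 1" and bd: "\<And>z. z \<in> ball 0 1 \<Longrightarrow> cmod (\<phi> z) \<le> 1"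
  obtains \<psi> where "\<psi> holomorphic_on ball 0 1" "\<And>z. z \<in> ball 0 1 \<Longrightarrow> cmod (\<psi> z) \<le> 1"
    "\<And>z. z \<in> ball 0 1 \<Longrightarrow> \<phi> z * (1 + cnj (\<phi> 0) * z * \<psi> z) = \<phi> 0 + z * \<psi> z"
proof (cases "\<exists>z\<in>ball 0 1. cmod (\<phi> z) = 1")
  case True
  then obtain w where w: "w \<in> ball 0 1" "cmod (\<phi> w) = 1" by blast
  have "\<phi> constant_on ball 0 1"
    by (rule maximum_modulus_principle[OF hol _ _ _ order_refl w(1)]) (use bd w in auto)
  then obtain b where "\<And>z. z \<in> ball 0 1 \<Longrightarrow> \<phi> z = b"
    unfolding constant_on_def by blast
  then show ?thesis by (intro that[of "\<lambda>_. 0"]) auto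
next
  case False
  then have lt: "cmod (\<phi> z) < 1" if "z \<in> ball 0 1" for z
    using bd[OF that] that by (auto simp: less_le)
  define g where "g = Moebius_function 0 (\<phi> 0) \<circ> \<phi>"
  have b: "cmod (\<phi> 0) < 1" using lt by simp
  have ghol: "g holomorphic_on ball 0 1"
    unfolding g_def by (rule holomorphic_on_compose_gen[OF hol Moebius_function_holomorphic]) (use lt b in auto)
  have glt: "cmod (g z) < 1" if "cmod z < 1" for z
    unfolding g_def o_def using b lt[of z] that by (intro Moebius_function_norm_lt_1) simp_all
  have g0: "g 0 = 0" by (simp add: g_def Moebius_function_eq_zero)
  obtain \<psi> where \<psi>: "\<psi> holomorphic_on ball 0 1" "\<And>z. cmod z < 1 \<Longrightarrow> g z = z * \<psi> z" "deriv g 0 = \<psi> 0"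
    using Schwarz3[OF ghol g0] by blast
  show ?thesis
  proof (rule that[OF \<psi>(1)])
    fix z :: complex assume z: "z \<in> ball 0 1"
    show "cmod (\<psi> z) \<le> 1"
    proof (cases "z = 0")
      case True
      then show ?thesis using Schwarz_Lemma(2)[OF ghol g0 glt, of 0] \<psi>(3) by simp
    next
      case False
      then show ?thesis using Schwarz_Lemma(1)[OF ghol g0 glt, of z] \<psi>(2)[of z] z
        by (simp add: norm_mult)
    qed
    have "cmod (cnj (\<phi> 0) * \<phi> z) \<le> cmod (\<phi> 0) * 1"
      unfolding norm_mult complex_mod_cnj using lt[OF z] by (intro mult_left_mono) auto
    then have "cnj (\<phi> 0) * \<phi> z \<noteq> 1" using b by auto
    then have "1 - cnj (\<phi> 0) * \<phi> z \<noteq> 0" by simp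
    moreover have "z * \<psi> z = (\<phi> z - \<phi> 0) / (1 - cnj (\<phi> 0) * \<phi> z)"
      using \<psi>(2)[of z] z by (simp add: g_def Moebius_function_simple)
    ultimately have "z * \<psi> z * (1 - cnj (\<phi> 0) * \<phi> z) = \<phi> z - \<phi> 0" by simp
    then show "\<phi> z * (1 + cnj (\<phi> 0) * z * \<psi> z) = \<phi> 0 + z * \<psi> z"
      by (simp add: algebra_simps)
  qed
qed

lemma has_fps_expansion_ball:
  assumes "f holomorphic_on ball 0 r" "0 < r"
  shows "f has_fps_expansion fps_expansion f 0"
  using assms by (intro has_fps_expansion_fps_expansion[of "ball 0 r"]) auto

lemma has_fps_expansion_eqI:
  fixes f :: "complex \<Rightarrow> complex"
  assumes "f has_fps_expansion F" "g has_fps_expansion G" "0 < r"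
    and eq: "\<And>z. z \<in> ball 0 r \<Longrightarrow> f z = g z"
  shows "F = G"
proof -
  have "eventually (\<lambda>z. z \<in> ball 0 r) (nhds (0::complex))"
    using \<open>0 < r\<close> by (intro eventually_nhds_in_open) auto
  then have "eventually (\<lambda>z. f z = g z) (nhds 0)"
    by eventually_elim (rule eq)
  then have "f has_fps_expansion G"
    using assms(2) by (simp add: has_fps_expansion_cong)
  then show ?thesis using assms(1) fps_expansion_unique_complex by blast
qed

text \<open>
  Three Schur steps \<open>\<omega> \<rightarrow> \<phi> \<rightarrow> \<psi> \<rightarrow> \<theta>\<close>; the parameters are \<open>c\<^sub>1 = \<phi>(0)\<close>, \<open>y = \<psi>(0)\<close> and
  \<open>v = \<theta>(0)\<close>, and the formulas come from comparing coefficients in the three equations.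
\<close>

lemma schur_parameters:
  fixes c :: "nat \<Rightarrow> complex"
  assumes hol: "\<omega> holomorphic_on ball 0 1" and bd: "\<And>z. z \<in> ball 0 1 \<Longrightarrow> cmod (\<omega> z) \<le> 1"
    and 0: "\<omega> 0 = 0"
  defines "c \<equiv> fps_nth (fps_expansion \<omega> 0)"
  obtains y v :: complex where "cmod (c 1) \<le> 1" "cmod y \<le> 1" "cmod v \<le> 1"
    "c 2 = (1 - (cmod (c 1))\<^sup>2) * y"
    "c 3 = (1 - (cmod (c 1))\<^sup>2) * ((1 - (cmod y)\<^sup>2) * v - cnj (c 1) * y\<^sup>2)"
proof -
  let ?B = "ball (0::complex) 1"
  obtain \<phi> where \<phi>: "\<phi> holomorphic_on ?B" "\<And>z. z \<in> ?B \<Longrightarrow> cmod (\<phi> z) \<le> 1"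
    "\<And>z. z \<in> ?B \<Longrightarrow> \<omega> z * (1 + cnj (\<omega> 0) * z * \<phi> z) = \<omega> 0 + z * \<phi> z"
    using schur_step[OF hol bd] by blast
  obtain \<psi> where \<psi>: "\<psi> holomorphic_on ?B" "\<And>z. z \<in> ?B \<Longrightarrow> cmod (\<psi> z) \<le> 1"
    "\<And>z. z \<in> ?B \<Longrightarrow> \<phi> z * (1 + cnj (\<phi> 0) * z * \<psi> z) = \<phi> 0 + z * \<psi> z"
    using schur_step[OF \<phi>(1,2)] by blast
  obtain \<theta> where \<theta>: "\<theta> holomorphic_on ?B" "\<And>z. z \<in> ?B \<Longrightarrow> cmod (\<theta> z) \<le> 1"
    "\<And>z. z \<in> ?B \<Longrightarrow> \<psi> z * (1 + cnj (\<psi> 0) * z * \<theta> z) = \<psi> 0 + z * \<theta> z"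
    using schur_step[OF \<psi>(1,2)] by blast
  define W P S C where "W = fps_expansion \<omega> 0" and "P = fps_expansion \<phi> 0"
    and "S = fps_expansion \<psi> 0" and "C = fps_expansion \<theta> 0"
  have exp: "\<omega> has_fps_expansion W" "\<phi> has_fps_expansion P" "\<psi> has_fps_expansion S" "\<theta> has_fps_expansion C"
    unfolding W_def P_def S_def C_def
    using hol \<phi>(1) \<psi>(1) \<theta>(1) by (auto intro!: has_fps_expansion_ball[of _ 1])
  have n0: "\<phi> 0 = fps_nth P 0" "\<psi> 0 = fps_nth S 0" "\<theta> 0 = fps_nth C 0"
    using exp by (auto simp: has_fps_expansion_imp_0_eq_fps_nth_0)
  have WP: "W = fps_X * P"
    by (rule has_fps_expansion_eqI[of \<omega> _ "\<lambda>z. z * \<phi> z" _ 1])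
       (use exp \<phi>(3) 0 in \<open>auto intro!: fps_expansion_intros\<close>)
  have PS: "P * (1 + fps_const (cnj (\<phi> 0)) * fps_X * S) = fps_const (\<phi> 0) + fps_X * S"
    by (rule has_fps_expansion_eqI[OF _ _ _ \<psi>(3)])
       (use exp in \<open>auto intro!: fps_expansion_intros\<close>)
  have SC: "S * (1 + fps_const (cnj (\<psi> 0)) * fps_X * C) = fps_const (\<psi> 0) + fps_X * C"
    by (rule has_fps_expansion_eqI[OF _ _ _ \<theta>(3)])
       (use exp in \<open>auto intro!: fps_expansion_intros\<close>)
  define y v where "y = \<psi> 0" and "v = \<theta> 0"
  have c: "c 1 = \<phi> 0" "c 2 = fps_nth P 1" "c 3 = fps_nth P 2"
    using WP by (auto simp: c_def W_def n0 numeral_2_eq_2 numeral_3_eq_3)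
  have "fps_nth (S * (1 + fps_const (cnj (\<psi> 0)) * fps_X * C)) 1 = fps_nth (fps_const (\<psi> 0) + fps_X * C) 1"
    by (simp only: SC)
  then have S1: "fps_nth S 1 + y * cnj y * v = v"
    by (simp add: fps_mult_nth y_def v_def n0 algebra_simps)
  have "fps_nth (P * (1 + fps_const (cnj (\<phi> 0)) * fps_X * S)) 1 = fps_nth (fps_const (\<phi> 0) + fps_X * S) 1"
    by (simp only: PS)
  then have "fps_nth P 1 + \<phi> 0 * cnj (\<phi> 0) * y = y"
    by (simp add: fps_mult_nth y_def n0 algebra_simps)
  then have P1: "c 2 + c 1 * cnj (c 1) * y = y"
    by (simp only: c)
  have "fps_nth (P * (1 + fps_const (cnj (\<phi> 0)) * fps_X * S)) 2 = fps_nth (fps_const (\<phi> 0) + fps_X * S) 2"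
    by (simp only: PS)
  then have "fps_nth P 2 + fps_nth P 1 * cnj (\<phi> 0) * y + \<phi> 0 * cnj (\<phi> 0) * fps_nth S 1 = fps_nth S 1"
    by (simp add: fps_mult_nth y_def n0 algebra_simps numeral_2_eq_2)
  then have P2: "c 3 + c 2 * cnj (c 1) * y + c 1 * cnj (c 1) * fps_nth S 1 = fps_nth S 1"
    by (simp only: c)
  show ?thesis
  proof (rule that[of y v])
    show "cmod (c 1) \<le> 1" "cmod y \<le> 1" "cmod v \<le> 1"
      using \<phi>(2)[of 0] \<psi>(2)[of 0] \<theta>(2)[of 0] unfolding c y_def v_def by simp_all
    show c2: "c 2 = (1 - (cmod (c 1))\<^sup>2) * y"
      using P1 unfolding of_real_diff of_real_1 complex_norm_square by (simp add: algebra_simps)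
    have S1': "fps_nth S 1 = (1 - (cmod y)\<^sup>2) * v"
      using S1 unfolding of_real_diff of_real_1 complex_norm_square by (simp add: algebra_simps)
    have "c 3 = (1 - (cmod (c 1))\<^sup>2) * fps_nth S 1 - c 2 * cnj (c 1) * y"
      using P2 unfolding of_real_diff of_real_1 complex_norm_square by (simp add: algebra_simps)
    then show "c 3 = (1 - (cmod (c 1))\<^sup>2) * ((1 - (cmod y)\<^sup>2) * v - cnj (c 1) * y\<^sup>2)"
      unfolding S1' c2 by (simp add: algebra_simps power2_eq_square)
  qed
qed

section \<open>The Hankel determinant in terms of Schwarz coefficients\<close>

text \<open>
  The inverse function is \<open>w exp (F w)\<close>, so the coefficients of \<open>F\<close> follow from the power
  series identity \<open>f(w exp (F w)) = w\<close> up to order \<open>4\<close>.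
\<close>

lemma hankel_inverse_coeffs:
  assumes hol: "f holomorphic_on ball 0 1" and f0: "f 0 = 0" "deriv f 0 = 1"
    and cover: "ball 0 (1/4) \<subseteq> f ` ball 0 1" and ex: "\<exists>F. is_log_inverse f F"
  defines "a \<equiv> fps_nth (fps_expansion f 0)"
  shows "48 * hankel_2_1 (log_inverse_coeff f) = 13 * a 2 ^ 4 - 12 * (a 2)\<^sup>2 * a 3 - 12 * (a 3)\<^sup>2 + 12 * a 2 * a 4"
proof -
  define F where "F = log_inverse f"
  have "is_log_inverse f F" unfolding F_def log_inverse_def using ex by (rule someI_ex)
  then have F: "F holomorphic_on ball 0 (1/4)" "F 0 = 0"
    "\<And>w. w \<in> ball 0 (1/4) - {0} \<Longrightarrow> exp (F w) = inv_into (ball 0 1) f w / w"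
    by (auto simp: is_log_inverse_def)
  define A G where "A = fps_expansion f 0" and "G = fps_expansion F 0"
  have exA: "f has_fps_expansion A" and exG: "F has_fps_expansion G"
    unfolding A_def G_def using hol F(1) by (auto intro: has_fps_expansion_ball)
  have G0: "fps_nth G 0 = 0" using has_fps_expansion_imp_0_eq_fps_nth_0[OF exG] F(2) by simp
  have A0: "fps_nth A 0 = 0" using has_fps_expansion_imp_0_eq_fps_nth_0[OF exA] f0 by simp
  have A1: "fps_nth A (Suc 0) = 1"
    using has_fps_expansion_imp_0_eq_fps_nth_0[OF has_fps_expansion_deriv[OF exA]] f0 by simp
  define E where "E = fps_exp 1 oo G"
  have exE: "(exp \<circ> F) has_fps_expansion E"
    unfolding E_def by (intro has_fps_expansion_compose has_fps_expansion_exp1 exG G0)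
  have "(\<lambda>w. w * (exp \<circ> F) w) has_fps_expansion fps_X * E"
    by (intro has_fps_expansion_mult has_fps_expansion_fps_X exE)
  then have "(f \<circ> (\<lambda>w. w * (exp \<circ> F) w)) has_fps_expansion (A oo (fps_X * E))"
    by (intro has_fps_expansion_compose exA) auto
  moreover have "(f \<circ> (\<lambda>w. w * (exp \<circ> F) w)) w = w" if w: "w \<in> ball 0 (1/4)" for w
  proof (cases "w = 0")
    case True
    then show ?thesis using f0 by simp
  next
    case False
    then have "w * exp (F w) = inv_into (ball 0 1) f w" using F(3)[of w] w by simp
    then show ?thesis using f_inv_into_f[of w f "ball 0 1"] w cover by auto
  qed
  ultimately have comp: "A oo (fps_X * E) = fps_X"
    using has_fps_expansion_eqI[OF _ has_fps_expansion_fps_X, where r = "1/4"] by simp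
  have dE: "fps_deriv E = E * fps_deriv G"
    unfolding E_def by (simp add: fps_compose_deriv G0)
  have E0: "fps_nth E 0 = 1" by (simp add: E_def)
  define e g where "e = fps_nth E" and "g = fps_nth G"
  have n: "(4::nat) = Suc (Suc (Suc (Suc 0)))" "(3::nat) = Suc (Suc (Suc 0))" "(2::nat) = Suc (Suc 0)" "(1::nat) = Suc 0"
    by simp_all
  have "fps_nth (fps_deriv E) 0 = fps_nth (E * fps_deriv G) 0" by (simp only: dE)
  then have e1: "e 1 = g 1" by (simp add: e_def g_def E0)
  have "fps_nth (fps_deriv E) 1 = fps_nth (E * fps_deriv G) 1" by (simp only: dE)
  then have e2: "2 * e 2 = 2 * g 2 + e 1 * g 1"
    by (simp add: e_def g_def E0 fps_mult_nth n)
  have "fps_nth (fps_deriv E) 2 = fps_nth (E * fps_deriv G) 2" by (simp only: dE)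
  then have e3: "3 * e 3 = 3 * g 3 + 2 * e 1 * g 2 + e 2 * g 1"
    by (simp add: e_def g_def E0 fps_mult_nth n)
  have comp_nth: "(\<Sum>i=0..k. fps_nth A i * (if k < i then 0 else fps_nth (E ^ i) (k - i))) = fps_nth fps_X k" for k
    using arg_cong[OF comp, of "\<lambda>g. fps_nth g k"]
    unfolding fps_compose_nth power_mult_distrib fps_X_power_mult_nth .
  have E_pow0: "fps_nth (E ^ k) 0 = 1" for k
    by (simp add: fps_nth_power_0 E0)
  have E21: "fps_nth (E ^ 2) 1 = 2 * e 1"
    by (simp add: power2_eq_square fps_mult_nth_1 E0 e_def)
  have E31: "fps_nth (E ^ 3) 1 = 3 * e 1"
    by (simp add: power3_eq_cube fps_mult_nth_1 E0 e_def)
  have a01: "a 0 = 0" "a 1 = 1" by (simp_all add: a_def A0 A1 flip: A_def)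
  have intervals: "{0..2} = {0,1,2::nat}" "{0..3} = {0,1,2,3::nat}" "{0..4} = {0,1,2,3,4::nat}" by auto
  have E22: "fps_nth (E ^ 2) 2 = 2 * e 2 + e 1 * e 1"
    unfolding power2_eq_square fps_mult_nth intervals by (simp add: E0 e_def)
  note E_pow = E_pow0 E21 E31 E22
  note comp_nth' = comp_nth[unfolded A_def a_def[symmetric]]
  have a1: "e 1 + a 2 = 0"
    using comp_nth'[of 2, unfolded intervals] a01 E_pow by (simp add: e_def algebra_simps)
  have a2: "e 2 + 2 * a 2 * e 1 + a 3 = 0"
    using comp_nth'[of 3, unfolded intervals] a01 E_pow by (simp add: e_def algebra_simps)
  have a3: "e 3 + a 2 * (2 * e 2 + e 1 * e 1) + 3 * a 3 * e 1 + a 4 = 0"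
    using comp_nth'[of 4, unfolded intervals] a01 E_pow by (simp add: e_def algebra_simps)
  have H: "4 * hankel_2_1 (log_inverse_coeff f) = g 1 * g 3 - (g 2)\<^sup>2"
    by (simp add: hankel_2_1_def log_inverse_coeff_def g_def G_def F_def power2_eq_square)
  define x y z where "x = a 2" and "y = a 3" and "z = a 4"
  have e1': "e 1 = - x" using a1 by (simp add: x_def eq_neg_iff_add_eq_0)
  have e2': "e 2 = 2 * x\<^sup>2 - y" using a2 e1' unfolding x_def[symmetric] y_def[symmetric] by algebra
  have e3': "e 3 = - 5 * x^3 + 5 * x * y - z"
    using a3 e1' e2' unfolding x_def[symmetric] y_def[symmetric] z_def[symmetric] by algebra
  have g1: "g 1 = - x" using e1 e1' by simp
  have g2: "2 * g 2 = 3 * x\<^sup>2 - 2 * y" using e2 g1 e1' e2' by algebra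
  have g3: "3 * g 3 = - 10 * x^3 + 12 * x * y - 3 * z" using e3 g1 g2 e1' e2' e3' by algebra
  show ?thesis using H g1 g2 g3 unfolding x_def[symmetric] y_def[symmetric] z_def[symmetric] by algebra
qed

text \<open>
  Put \<open>Q = 1 + z f''/f'\<close>. The coefficients of \<open>Q\<close> are found from its logarithmic derivative,
  \<open>Q' (1 - \<omega>\<^sup>2) = 2 \<alpha> \<omega>' Q\<close>, and those of \<open>f\<close> from \<open>f' + z f'' = Q f'\<close>.
\<close>

lemma hankel_schwarz_coeffs:
  fixes \<alpha> :: real and \<omega> :: "complex \<Rightarrow> complex" and c :: "nat \<Rightarrow> complex"
  assumes hol: "f holomorphic_on ball 0 1" and f0: "f 0 = 0" "deriv f 0 = 1"
    and f': "\<And>z. z \<in> ball 0 1 \<Longrightarrow> deriv f z \<noteq> 0"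
    and cover: "ball 0 (1/4) \<subseteq> f ` ball 0 1" and ex: "\<exists>F. is_log_inverse f F"
    and \<omega>: "\<omega> holomorphic_on ball 0 1" "\<And>z. z \<in> ball 0 1 \<Longrightarrow> cmod (\<omega> z) < 1" "\<omega> 0 = 0"
    and eq: "\<And>z. z \<in> ball 0 1 \<Longrightarrow>
       1 + z * deriv (deriv f) z / deriv f z = ((1 + \<omega> z) / (1 - \<omega> z)) powr \<alpha>"
  defines "c \<equiv> fps_nth (fps_expansion \<omega> 0)"
  shows "hankel_2_1 (log_inverse_coeff f)
    = \<alpha>\<^sup>2 / 144 * ((2+\<alpha>\<^sup>2) * c 1 ^ 4 - 6 * \<alpha> * (c 1)\<^sup>2 * c 2 - 4 * (c 2)\<^sup>2 + 6 * c 1 * c 3)"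
proof -
  define Q where "Q = (\<lambda>z. ((1 + \<omega> z) / (1 - \<omega> z)) powr \<alpha>)"
  have ne: "1 - \<omega> z \<noteq> 0" "1 + \<omega> z \<noteq> 0" if "z \<in> ball 0 1" for z
    using \<omega>(2)[OF that] by (auto simp: add_eq_0_iff norm_minus_cancel)
  have slit: "(1 + \<omega> z) / (1 - \<omega> z) \<notin> \<real>\<^sub>\<le>\<^sub>0" if "z \<in> ball 0 1" for z
    using Re_cayley_pos[OF \<omega>(2)[OF that]] by (auto simp: complex_nonpos_Reals_iff)
  have dQ: "(Q has_field_derivative 2 * \<alpha> * deriv \<omega> z * Q z / (1 - (\<omega> z)\<^sup>2)) (at z)" if z: "z \<in> ball 0 1" for z
  proof -
    have d\<omega>: "(\<omega> has_field_derivative deriv \<omega> z) (at z)"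
      using \<omega>(1) z by (intro holomorphic_derivI) auto
    define R where "R = (\<lambda>z. (1 + \<omega> z) / (1 - \<omega> z))"
    have dR: "(R has_field_derivative 2 * deriv \<omega> z / (1 - \<omega> z)\<^sup>2) (at z)"
      unfolding R_def using d\<omega> ne[OF z]
      by (auto intro!: derivative_eq_intros simp: power2_eq_square field_simps)
    have "((\<lambda>z. exp (\<alpha> * Ln (R z))) has_field_derivative
        exp (\<alpha> * Ln (R z)) * (\<alpha> * (inverse (R z) * (2 * deriv \<omega> z / (1 - \<omega> z)\<^sup>2)))) (at z)"
      using slit[OF z] dR by (intro DERIV_exp[THEN DERIV_chain2] DERIV_cmult has_field_derivative_Ln[THEN DERIV_chain2]) (auto simp: R_def)
    moreover have "exp (\<alpha> * Ln (R w)) = Q w" if "w \<in> ball 0 1" for w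
      using slit[OF that] ne[OF that] by (auto simp: powr_def Q_def R_def)
    ultimately have "(Q has_field_derivative
        exp (\<alpha> * Ln (R z)) * (\<alpha> * (inverse (R z) * (2 * deriv \<omega> z / (1 - \<omega> z)\<^sup>2)))) (at z)"
      using z by (elim has_field_derivative_transform_within_open[where S = "ball 0 1"]) auto
    moreover have "\<alpha> * (inverse (R z) * (2 * deriv \<omega> z / (1 - \<omega> z)\<^sup>2)) = 2 * \<alpha> * deriv \<omega> z / (1 - (\<omega> z)\<^sup>2)"
    proof -
      have "1 - (\<omega> z)\<^sup>2 = (1 - \<omega> z) * (1 + \<omega> z)" by algebra
      moreover have "t * (inverse (w / v) * (2 * d / v\<^sup>2)) = 2 * t * d / (v * w)" if "v \<noteq> 0" "w \<noteq> 0" for t v w d :: complex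
        using that by (simp add: power2_eq_square mult_ac)
      ultimately show ?thesis using ne[OF z] unfolding R_def by simp
    qed
    ultimately have "(Q has_field_derivative Q z * (2 * \<alpha> * deriv \<omega> z / (1 - (\<omega> z)\<^sup>2))) (at z)"
      by (simp only: \<open>\<And>w. w \<in> ball 0 1 \<Longrightarrow> exp (\<alpha> * Ln (R w)) = Q w\<close>[OF z])
    then show ?thesis by (simp add: mult_ac)
  qed
  have Qhol: "Q holomorphic_on ball 0 1" using dQ by (meson holomorphic_on_open open_ball)
  define A W K where "A = fps_expansion f 0" and "W = fps_expansion \<omega> 0" and "K = fps_expansion Q 0"
  have exA: "f has_fps_expansion A" and exW: "\<omega> has_fps_expansion W" and exK: "Q has_fps_expansion K"
    unfolding A_def W_def K_def using hol \<omega>(1) Qhol by (auto intro: has_fps_expansion_ball)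
  have A0: "fps_nth A 0 = 0" using has_fps_expansion_imp_0_eq_fps_nth_0[OF exA] f0 by simp
  have A1: "fps_nth A (Suc 0) = 1"
    using has_fps_expansion_imp_0_eq_fps_nth_0[OF has_fps_expansion_deriv[OF exA]] f0 by simp
  have W0: "fps_nth W 0 = 0" using has_fps_expansion_imp_0_eq_fps_nth_0[OF exW] \<omega>(3) by simp
  have K0: "fps_nth K 0 = 1" using has_fps_expansion_imp_0_eq_fps_nth_0[OF exK] \<omega>(3) by (simp add: Q_def)
  have QA: "fps_deriv A + fps_X * fps_deriv (fps_deriv A) = K * fps_deriv A"
  proof (rule has_fps_expansion_eqI[where r = 1])
    show "(\<lambda>z. deriv f z + z * deriv (deriv f) z) has_fps_expansion fps_deriv A + fps_X * fps_deriv (fps_deriv A)"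
      by (intro fps_expansion_intros exA)
    show "(\<lambda>z. Q z * deriv f z) has_fps_expansion K * fps_deriv A"
      by (intro fps_expansion_intros exA exK)
    fix z :: complex assume z: "z \<in> ball 0 1"
    show "deriv f z + z * deriv (deriv f) z = Q z * deriv f z"
      using f'[OF z] eq[OF z] by (simp add: Q_def field_simps)
  qed simp
  have QW: "fps_deriv K * (1 - W * W) = fps_const (2 * \<alpha>) * fps_deriv W * K"
  proof (rule has_fps_expansion_eqI[where r = 1])
    show "(\<lambda>z. deriv Q z * (1 - \<omega> z * \<omega> z)) has_fps_expansion fps_deriv K * (1 - W * W)"
      by (intro fps_expansion_intros exW exK)
    show "(\<lambda>z. complex_of_real (2 * \<alpha>) * deriv \<omega> z * Q z) has_fps_expansion fps_const (complex_of_real (2 * \<alpha>)) * fps_deriv W * K"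
      by (intro fps_expansion_intros exW exK)
    fix z :: complex assume z: "z \<in> ball 0 1"
    have "1 - \<omega> z * \<omega> z = (1 - \<omega> z) * (1 + \<omega> z)" by algebra
    then have "1 - \<omega> z * \<omega> z \<noteq> 0" using ne[OF z] by simp
    then show "deriv Q z * (1 - \<omega> z * \<omega> z) = complex_of_real (2 * \<alpha>) * deriv \<omega> z * Q z"
      using DERIV_imp_deriv[OF dQ[OF z]] by (simp add: power2_eq_square)
  qed simp
  have n: "(4::nat) = Suc (Suc (Suc (Suc 0)))" "(3::nat) = Suc (Suc (Suc 0))" "(2::nat) = Suc (Suc 0)" "(1::nat) = Suc 0"
    by simp_all
  define a q where "a = fps_nth A" and "q = fps_nth K"
  have "fps_nth (fps_deriv K * (1 - W * W)) 0 = fps_nth (fps_const (2 * \<alpha>) * fps_deriv W * K) 0" by (simp only: QW)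
  then have q1: "q 1 = 2 * \<alpha> * c 1" by (simp add: q_def c_def K0 W0 flip: W_def)
  have "fps_nth (fps_deriv K * (1 - W * W)) 1 = fps_nth (fps_const (2 * \<alpha>) * fps_deriv W * K) 1" by (simp only: QW)
  then have q2: "2 * q 2 = 2 * \<alpha> * (2 * c 2 + c 1 * q 1)"
    by (simp add: q_def c_def K0 W0 fps_mult_nth n algebra_simps flip: W_def)
  have "fps_nth (fps_deriv K * (1 - W * W)) 2 = fps_nth (fps_const (2 * \<alpha>) * fps_deriv W * K) 2" by (simp only: QW)
  then have q3: "3 * q 3 - q 1 * (c 1)\<^sup>2 = 2 * \<alpha> * (3 * c 3 + 2 * c 2 * q 1 + c 1 * q 2)"
    by (simp add: q_def c_def K0 W0 fps_mult_nth n algebra_simps flip: W_def)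
  have "fps_nth (fps_deriv A + fps_X * fps_deriv (fps_deriv A)) 1 = fps_nth (K * fps_deriv A) 1" by (simp only: QA)
  then have a2: "2 * a 2 = q 1" by (simp add: a_def q_def K0 A1 fps_mult_nth n algebra_simps)
  have "fps_nth (fps_deriv A + fps_X * fps_deriv (fps_deriv A)) 2 = fps_nth (K * fps_deriv A) 2" by (simp only: QA)
  then have a3: "6 * a 3 = q 2 + 2 * a 2 * q 1" by (simp add: a_def q_def K0 A1 fps_mult_nth n algebra_simps)
  have "fps_nth (fps_deriv A + fps_X * fps_deriv (fps_deriv A)) 3 = fps_nth (K * fps_deriv A) 3" by (simp only: QA)
  then have a4: "12 * a 4 = q 3 + 2 * a 2 * q 2 + 3 * a 3 * q 1" by (simp add: a_def q_def K0 A1 fps_mult_nth n algebra_simps)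
  define t c1 c2 c3 where "t = complex_of_real \<alpha>" and "c1 = c 1" and "c2 = c 2" and "c3 = c 3"
  note fold = of_real_mult of_real_numeral t_def[symmetric] c1_def[symmetric] c2_def[symmetric] c3_def[symmetric]
  have q1': "q 1 = 2 * t * c1" using q1 unfolding fold by simp
  have q2': "q 2 = 2 * t * c2 + 2 * t\<^sup>2 * c1\<^sup>2" using q2 q1' unfolding fold by algebra
  have q3': "3 * q 3 = 6 * t * c3 + 2 * t * c1^3 + 12 * t\<^sup>2 * c1 * c2 + 4 * t^3 * c1^3"
    using q3 q1' q2' unfolding fold by algebra
  have a2': "a 2 = t * c1" using a2 q1' by simp
  have a3': "3 * a 3 = t * c2 + 3 * t\<^sup>2 * c1\<^sup>2" using a3 q1' q2' a2' by algebra
  have a4': "18 * a 4 = 3 * t * c3 + 15 * t\<^sup>2 * c1 * c2 + t * c1^3 + 17 * t^3 * c1^3"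
    using a4 q1' q2' q3' a2' a3' by algebra
  have "48 * hankel_2_1 (log_inverse_coeff f) = 13 * a 2 ^ 4 - 12 * (a 2)\<^sup>2 * a 3 - 12 * (a 3)\<^sup>2 + 12 * a 2 * a 4"
    using hankel_inverse_coeffs[OF hol f0 cover ex] by (simp add: a_def A_def)
  then have "144 * hankel_2_1 (log_inverse_coeff f)
    = t\<^sup>2 * ((2+t\<^sup>2) * c1 ^ 4 - 6 * t * c1\<^sup>2 * c2 - 4 * c2\<^sup>2 + 6 * c1 * c3)"
    using a2' a3' a4' by algebra
  then show ?thesis unfolding fold by (simp add: t_def mult.commute)
qed

section \<open>The extremal problem for the Schur parameters\<close>

text \<open>
  The last hypothesis is \<open>B(K - A) < 4AK\<close> from \<open>circle_quadratic_bound\<close> after cancelling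
  \<open>2s(1 - s)\<close>; it says that the vertex of the quadratic there lies to the left of \<open>1\<close>. Its left
  side decreases and its right side increases with \<open>s\<close>, so it suffices that it fails at \<open>s = 3a(2 - a)/10\<close>, a convenient lower
  estimate for the exact threshold.
\<close>

lemma interior_critical_point_threshold:
  fixes a s :: real
  assumes "0 < a" "a \<le> 1" "0 \<le> s"
    and "3 * a * (4 - 2 * s - (4+a\<^sup>2) * s\<^sup>2) < 4 * (2+a\<^sup>2) * s * (2+s)"
  shows "3*a*(2-a)/10 < s"
proof (rule ccontr)
  define r where "r = 3*a*(2-a)/10"
  assume "\<not> 3*a*(2-a)/10 < s"
  then have sr: "s \<le> r" by (simp add: r_def)
  have "s\<^sup>2 \<le> r\<^sup>2" using sr assms by (simp add: power_mono)
  have "4 * (2+a\<^sup>2) * s * (2+s) \<le> 4 * (2+a\<^sup>2) * r * (2+r)"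
    using sr assms by (intro mult_mono) auto
  moreover have "3 * a * (4 - 2*r - (4+a\<^sup>2)*r\<^sup>2) \<le> 3 * a * (4 - 2 * s - (4+a\<^sup>2) * s\<^sup>2)"
    using sr assms \<open>s\<^sup>2 \<le> r\<^sup>2\<close> by (intro mult_left_mono diff_mono) auto
  moreover have "4 * (2+a\<^sup>2) * r * (2+r) \<le> 3 * a * (4 - 2*r - (4+a\<^sup>2)*r\<^sup>2)"
  proof -
    \<comment> \<open>The Bernstein form of the difference on \<open>[0, 1]\<close>, whose coefficients are all positive.\<close>
    have "3 * a * (4 - 2*r - (4+a\<^sup>2)*r\<^sup>2) - 4 * (2+a\<^sup>2) * r * (2+r)
        = a * (12/5*(1-a)^6 + 318/25*a*(1-a)^5 + 579/25*a^2*(1-a)^4 + 18*a^3*(1-a)^3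
               + 138/25*a^4*(1-a)^2 + 6/5*a^5*(1-a) + 57/100*a^6)"
      unfolding r_def by (simp add: field_simps) algebra
    also have "0 \<le> \<dots>"
      using assms by (intro mult_nonneg_nonneg add_nonneg_nonneg) auto
    finally show ?thesis by simp
  qed
  ultimately show False using assms by linarith
qed

text \<open>
  The left side bounds the interior maximum of the modulus on the unit circle. It decreases with
  \<open>s\<close>, so only the smallest \<open>s\<close> has to be checked. The second hypothesis on \<open>M\<close> is the value of
  \<open>4 + (6a - 2)t - (4 + 6a + a\<^sup>2)t\<^sup>2\<close> at \<open>t = 1/6\<close>; it is needed when \<open>a\<close> is close to \<open>1\<close>, where the left
  side can exceed \<open>4\<close>.
\<close>

lemma interior_maximum_bound:
  fixes a s M :: real
  assumes a: "0 < a" "a \<le> 1" and s: "3*a*(2-a)/10 \<le> s" "s \<le> 1"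
    and M: "4 \<le> M" "4 + (6*a-2)/6 - (4+6*a+a\<^sup>2)/36 \<le> M"
  shows "(4 - 2 * s + a\<^sup>2 * s\<^sup>2) * (1 + 9*a\<^sup>2*(1-s)/(4*(2+a\<^sup>2)*(2+s))) \<le> M"
proof -
  define r where "r = 3*a*(2-a)/10"
  define g where "g = 9*a\<^sup>2/(4*(2+a\<^sup>2))"
  have g0: "0 \<le> g" by (simp add: g_def)
  have r: "0 \<le> r" "r \<le> s" using a s by (auto simp: r_def)
  have a2: "a\<^sup>2 \<le> 1" using a by (simp add: power_le_one)
  have as: "a\<^sup>2 * s\<^sup>2 \<le> s\<^sup>2" using a2 by (simp add: mult_left_le_one_le)
  \<comment> \<open>This removes the denominator \<open>2 + s\<close> at little cost for the small \<open>s\<close> that matter.\<close>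
  have "(4 - 2 * s + a\<^sup>2 * s\<^sup>2) \<le> (2+s)*(2-2 * s+3/2 * s\<^sup>2)"
  proof -
    have "0 \<le> s^3" using r by simp
    moreover have "(2+s)*(2-2 * s+3/2 * s\<^sup>2) = 4-2 * s+s\<^sup>2+3/2 * s^3"
      by algebra
    ultimately show ?thesis using as by linarith
  qed
  then have "(4 - 2 * s + a\<^sup>2 * s\<^sup>2)/(2+s) \<le> 2-2 * s+3/2 * s\<^sup>2"
    using r by (simp add: divide_le_eq mult.commute)
  then have "(1-s)*((4 - 2 * s + a\<^sup>2 * s\<^sup>2)/(2+s)) \<le> (1-s)*(2-2 * s+3/2 * s\<^sup>2)"
    using s by (intro mult_left_mono) auto
  also have "\<dots> \<le> (1-r)*(2-2*r+3/2*r\<^sup>2)"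
  proof -
    have "(1-r)*(2-2*r+3/2*r\<^sup>2) - (1-s)*(2-2 * s+3/2 * s\<^sup>2)
        = (s-r)*(4 - 7/2*(s+r) + 3/2*(s\<^sup>2+s*r+r\<^sup>2))" by algebra
    moreover have "0 \<le> 4 - 7/2*(s+r) + 3/2*(s\<^sup>2+s*r+r\<^sup>2)"
    proof -
      have "4 - 7/2*(s+r) + 3/2*(s\<^sup>2+s*r+r\<^sup>2) = 9/8*(s+r-14/9)\<^sup>2 + 3/8*(s-r)\<^sup>2 + (4 - 9/8*(14/9)\<^sup>2)"
        by algebra
      moreover have "(0::real) \<le> 4 - 9/8*(14/9)\<^sup>2" by (simp add: power2_eq_square)
      moreover have "0 \<le> 9/8*(s+r-14/9)\<^sup>2" "0 \<le> 3/8*(s-r)\<^sup>2" by auto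
      ultimately show ?thesis by linarith
    qed
    ultimately show ?thesis using r
      by (metis diff_ge_0_iff_ge mult_nonneg_nonneg)
  qed
  finally have 1: "g * ((1-s)*((4 - 2 * s + a\<^sup>2 * s\<^sup>2)/(2+s))) \<le> g * ((1-r)*(2-2*r+3/2*r\<^sup>2))"
    using g0 by (rule mult_left_mono)
  have "0 \<le> (s-r)*(2-a\<^sup>2*(s+r))"
  proof (rule mult_nonneg_nonneg)
    have "a\<^sup>2*(s+r) \<le> 1*2" using a2 s r by (intro mult_mono) auto
    then show "0 \<le> 2-a\<^sup>2*(s+r)" by simp
  qed (use r in auto)
  also have "(s-r)*(2-a\<^sup>2*(s+r)) = (2 * s - a\<^sup>2 * s\<^sup>2) - (2*r - a\<^sup>2*r\<^sup>2)" by algebra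
  finally have 2: "2*r - a\<^sup>2*r\<^sup>2 \<le> 2 * s - a\<^sup>2 * s\<^sup>2" by simp
  have 3: "g * ((1-r)*(2-2*r+3/2*r\<^sup>2)) \<le> 2*r - a\<^sup>2*r\<^sup>2 + (M - 4)"
  proof -
    have step: ?thesis
      if m: "m \<le> M - 4"
        and d: "0 \<le> 4*(2+a\<^sup>2)*(2*r - a\<^sup>2*r\<^sup>2 + m) - 9*a\<^sup>2*((1-r)*(2-2*r+3/2*r\<^sup>2))" for m
    proof -
      have "0 < 4*(2+a\<^sup>2)" by (simp add: add_pos_nonneg)
      then have "g * ((1-r)*(2-2*r+3/2*r\<^sup>2)) \<le> 2*r - a\<^sup>2*r\<^sup>2 + m"
        using d unfolding g_def by (simp add: divide_le_eq mult.commute)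
      then show ?thesis using m by simp
    qed
    \<comment> \<open>After clearing the denominator of \<open>g\<close>, positivity is read off from the Bernstein forms on
      \<open>[0, 2/3]\<close> and \<open>[2/3, 1]\<close>. On the second interval \<open>M - 4 \<ge> a - 16/25\<close> is used.\<close>
    show ?thesis
    proof (cases "a \<le> 2/3")
      case True
      have "4*(2+a\<^sup>2)*(2*r - a\<^sup>2*r\<^sup>2 + 0) - 9*a\<^sup>2*((1-r)*(2-2*r+3/2*r\<^sup>2))
          = 3/40*a*(2-3*a)^7 + 39/32*a^2*(2-3*a)^6 + 687/80*a^3*(2-3*a)^5
            + 13377/400*a^4*(2-3*a)^4 + 76077/1000*a^5*(2-3*a)^3 + 194049/2000*a^6*(2-3*a)^2
            + 115893/2000*a^7*(2-3*a) + 29799/4000*a^8"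
        unfolding r_def by (simp add: field_simps) algebra
      also have "0 \<le> \<dots>"
        using a True by (intro mult_nonneg_nonneg add_nonneg_nonneg) auto
      finally show ?thesis using step[of 0] M by simp
    next
      case False
      have "4*(2+a\<^sup>2)*(2*r - a\<^sup>2*r\<^sup>2 + (a - 16/25)) - 9*a\<^sup>2*((1-r)*(2-2*r+3/2*r\<^sup>2))
          = 452232/125*(1-a)^8 + 1500624/125*(3*a-2)*(1-a)^7 + 2029536/125*(3*a-2)^2*(1-a)^6
            + 1492938/125*(3*a-2)^3*(1-a)^5 + 131892/25*(3*a-2)^4*(1-a)^4
            + 179641/125*(3*a-2)^5*(1-a)^3 + 235301/1000*(3*a-2)^6*(1-a)^2
            + 21009/1000*(3*a-2)^7*(1-a) + 1539/2000*(3*a-2)^8"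
        unfolding r_def by (simp add: field_simps) algebra
      also have "0 \<le> \<dots>"
        using a False by (intro mult_nonneg_nonneg add_nonneg_nonneg) auto
      finally show ?thesis using M a2 a
        by (intro step[of "a - 16/25"]) (auto simp: field_simps)
    qed
  qed
  have "(4 - 2 * s + a\<^sup>2 * s\<^sup>2) * (1 + 9*a\<^sup>2*(1-s)/(4*(2+a\<^sup>2)*(2+s)))
      = 4 - (2 * s - a\<^sup>2 * s\<^sup>2) + g * ((1-s)*((4 - 2 * s + a\<^sup>2 * s\<^sup>2)/(2+s)))"
  proof -
    have "t * (1 + n*(1-s)/(d*(2+s))) = t + n/d * ((1-s)*(t/(2+s)))" for t n d :: real
      by (simp add: distrib_left)
    from this[of "4 - 2 * s + a\<^sup>2 * s\<^sup>2" "9*a\<^sup>2" "4*(2+a\<^sup>2)"] show ?thesis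
      unfolding g_def by linarith
  qed
  also have "\<dots> \<le> M" using 1 2 3 by linarith
  finally show ?thesis .
qed

text \<open>
  If \<open>4AK \<le> B(K - A)\<close>, the concave quadratic in \<open>u\<close> increases up to \<open>u = 1\<close>, where its value is
  \<open>(K - A + B)\<^sup>2\<close>. Otherwise its maximum is at most \<open>(A + K)\<^sup>2 (1 + B\<^sup>2/(4AK))\<close>, which is small enough
  because \<open>s\<close> is then bounded away from \<open>0\<close>.
\<close>

lemma circle_quadratic_bound:
  fixes a s u M :: real
  assumes a: "0 < a" "a \<le> 1" and s: "0 \<le> s" "s \<le> 1" and u: "-1 \<le> u" "u \<le> 1"
    and M: "\<And>t. 0 \<le> t \<Longrightarrow> t \<le> 1 \<Longrightarrow> 4 + (6*a-2)*t - (4+6*a+a\<^sup>2)*t\<^sup>2 \<le> M"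
    and A: "A = (2+a\<^sup>2) * s\<^sup>2" and B: "B = 6*a * s*(1-s)" and K: "K = (1-s)*(4+2 * s)"
  shows "(A+K)\<^sup>2 + B\<^sup>2 + 2*B*(K-A)*u - 4*A*K*u\<^sup>2 \<le> M\<^sup>2"
proof -
  have a2: "a\<^sup>2 \<le> 1" using a by (simp add: power_le_one)
  have s2: "s\<^sup>2 \<le> 1" using s by (simp add: power_le_one)
  have M4: "4 \<le> M" using M[of 0] by simp
  have A0: "0 \<le> A" "A \<le> 3" and B0: "0 \<le> B" and K0: "0 \<le> K"
    using s a a2 s2 mult_mono[of "2+a\<^sup>2" 3 "s\<^sup>2" 1] by (auto simp: A B K)
  show ?thesis
  proof (cases "4*A*K \<le> B*(K-A)")
    case True
    have "(A+K)\<^sup>2 + B\<^sup>2 + 2*B*(K-A)*u - 4*A*K*u\<^sup>2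
        = (K-A+B)\<^sup>2 - (1-u)*(2*(B*(K-A)) - 4*A*K*(1+u))" by algebra
    moreover have "4*A*K*(1+u) \<le> 4*A*K*2" using u A0 K0 by (intro mult_left_mono) auto
    then have "0 \<le> (1-u)*(2*(B*(K-A)) - 4*A*K*(1+u))" using True u by (intro mult_nonneg_nonneg) auto
    moreover have "(K-A+B)\<^sup>2 \<le> M\<^sup>2"
      using M[OF s] M4 A0 B0 K0
      by (intro power2_le_iff_abs_le[THEN iffD2]) (auto simp: A B K power2_eq_square algebra_simps abs_le_iff)
    ultimately show ?thesis by linarith
  next
    case False
    have s01: "0 < s" "s < 1" using False s A B K
      by (auto simp: less_le)
    have "3*a*(2-a)/10 < s"
    proof (rule interior_critical_point_threshold)
      have "(2 * s*(1-s)) * (3 * a * (4 - 2 * s - (4+a\<^sup>2) * s\<^sup>2)) = B*(K-A)" unfolding A B K by algebra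
      also have "\<dots> < 4*A*K" using False by simp
      also have "4*A*K = (2 * s*(1-s)) * (4 * (2+a\<^sup>2) * s * (2+s))" unfolding A B K by algebra
      finally show "3 * a * (4 - 2 * s - (4+a\<^sup>2) * s\<^sup>2) < 4 * (2+a\<^sup>2) * s * (2+s)"
        using s01 by (simp only: mult_less_cancel_left_pos[OF mult_pos_pos[OF mult_pos_pos[OF zero_less_numeral]], of s "1-s"] diff_gt_0_iff_gt)
    qed (use a s in auto)
    \<comment> \<open>Half of \<open>B\<^sup>2/(4AK)\<close>, so that \<open>1 + b\<close> bounds the square root of \<open>1 + B\<^sup>2/(4AK)\<close>.\<close>
    define b where "b = 9*a\<^sup>2*(1-s)/(4*(2+a\<^sup>2)*(2+s))"
    have "0 < A" using s01 a by (auto simp: A intro!: mult_pos_pos add_pos_nonneg)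
    have "0 < K" using s01 by (auto simp: K)
    have "b * (4*(2+a\<^sup>2)*(2+s)) = 9*a\<^sup>2*(1-s)"
      using s01 add_pos_nonneg[of 2 "a\<^sup>2"] by (simp add: b_def)
    then have bB: "8*A*K*b = B\<^sup>2" unfolding A B K by algebra
    have "b \<ge> 0" using s01 by (auto simp: b_def)
    have "(A+K)*(1+b) \<le> M"
    proof -
      have "A+K = 4 - 2 * s + a\<^sup>2 * s\<^sup>2" unfolding A K by algebra
      then show ?thesis unfolding b_def
        using interior_maximum_bound[of a s M] a s M4 M[of "1/6"] \<open>3*a*(2-a)/10 < s\<close> by (simp add: power2_eq_square)
    qed
    then have "((A+K)*(1+b))\<^sup>2 \<le> M\<^sup>2" using A0 K0 \<open>b \<ge> 0\<close> by (intro power_mono) auto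
    moreover have "(A+K)\<^sup>2*(1+2*b) \<le> ((A+K)*(1+b))\<^sup>2"
    proof -
      have "((A+K)*(1+b))\<^sup>2 - (A+K)\<^sup>2*(1+2*b) = ((A+K)*b)\<^sup>2" by algebra
      then show ?thesis using zero_le_power2[of "(A+K)*b"] by linarith
    qed
    moreover have "4*A*K*((A+K)\<^sup>2*(1+2*b) - ((A+K)\<^sup>2 + B\<^sup>2 + 2*B*(K-A)*u - 4*A*K*u\<^sup>2))
       = (4*A*K*u - B*(K-A))\<^sup>2" using bB by algebra
    then have "0 \<le> (A+K)\<^sup>2*(1+2*b) - ((A+K)\<^sup>2 + B\<^sup>2 + 2*B*(K-A)*u - 4*A*K*u\<^sup>2)"
      using \<open>0 < A\<close> \<open>0 < K\<close> by (metis mult_pos_pos zero_le_power2 zero_le_mult_iff zero_less_numeral not_less)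
    ultimately show ?thesis by linarith
  qed
qed

text \<open>
  This is \<open>A + B/2 + D \<le> 4\<close> for the coefficients in \<open>schur_functional_bound\<close> with \<open>s = x\<^sup>2\<close>. The
  left side is at most \<open>3x\<^sup>2 + 6x - 6x\<^sup>3\<close>. For \<open>x \<ge> 0\<close> this cubic lies below its tangent at
  \<open>x = 77/100\<close>, a point close to its maximum, and the tangent lies below \<open>4\<close>.
\<close>

lemma inner_part_bound:
  fixes a x :: real
  assumes "0 \<le> a" "a \<le> 1" "0 \<le> x" "x \<le> 1"
  shows "(2+a\<^sup>2)*(x\<^sup>2)\<^sup>2 + 6*a*x\<^sup>2*(1-x\<^sup>2)/2 + 6*(1-x\<^sup>2)*x \<le> 4"
proof -
  have "(2+a\<^sup>2)*(x\<^sup>2)\<^sup>2 \<le> 3*(x\<^sup>2)\<^sup>2" using assms by (intro mult_right_mono) (auto simp: power_le_one)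
  moreover have "6*a*x\<^sup>2*(1-x\<^sup>2)/2 \<le> 6*1*x\<^sup>2*(1-x\<^sup>2)/2"
    using assms by (intro divide_right_mono mult_right_mono) (auto simp: power_le_one)
  moreover have "4 - (3*(x\<^sup>2)\<^sup>2 + 6*1*x\<^sup>2*(1-x\<^sup>2)/2 + 6*(1-x\<^sup>2)*x)
      = 6*(x-77/100)\<^sup>2*(x+104/100) + 522/10000*x + 300304/1000000"
    by (simp add: field_simps) algebra
  moreover have "0 \<le> 6*(x-77/100)\<^sup>2*(x+104/100) + 522/10000*x + 300304/1000000"
    using assms by (intro add_nonneg_nonneg mult_nonneg_nonneg) auto
  ultimately show ?thesis by linarith
qed

lemma unit_circle_polynomial_bound:
  fixes e :: complex and A B K M :: real
  assumes e: "cmod e = 1" and "0 \<le> M"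
    and le: "\<And>u. -1 \<le> u \<Longrightarrow> u \<le> 1 \<Longrightarrow> (A+K)\<^sup>2 + B\<^sup>2 + 2*B*(K-A)*u - 4*A*K*u\<^sup>2 \<le> M\<^sup>2"
  shows "cmod (A - B * e - K * e\<^sup>2) \<le> M"
proof -
  define p q where "p = Re e" and "q = Im e"
  have pq: "p\<^sup>2 + q\<^sup>2 = 1" using e by (simp add: p_def q_def cmod_def)
  have "\<bar>p\<bar> \<le> 1" using abs_Re_le_cmod[of e] e by (simp add: p_def)
  have "(cmod (A - B * e - K * e\<^sup>2))\<^sup>2 = (A - B*p - K*(p\<^sup>2 - q\<^sup>2))\<^sup>2 + (- (B*q) - K*(2*(q*p)))\<^sup>2"
    unfolding cmod_power2 by (simp add: p_def q_def power2_eq_square)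
  also have "\<dots> = (A+K)\<^sup>2 + B\<^sup>2 + 2*B*(K-A)*p - 4*A*K*p\<^sup>2"
    using pq by algebra
  also have "\<dots> \<le> M\<^sup>2" using \<open>\<bar>p\<bar> \<le> 1\<close> by (intro le) auto
  finally show ?thesis using \<open>0 \<le> M\<close> by (rule power2_le_imp_le)
qed

text \<open>
  For \<open>\<bar>y\<bar> = t\<close>, the polynomial \<open>A - B y - K y\<^sup>2\<close> is split into \<open>t\<^sup>2\<close> times its value at the point
  \<open>e\<close> of the unit circle in the direction of \<open>y\<close>, plus \<open>(1 - t\<^sup>2) A\<close> and a term of modulus
  \<open>t (1 - t) B \<le> (1 - t\<^sup>2) B/2\<close>. Together with the term of modulus at most \<open>(1 - t\<^sup>2) D\<close> coming from \<open>v\<close>,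
  the functional is bounded by a convex combination of the maximum on the circle and \<open>A + B/2 + D\<close>.
\<close>

lemma schur_functional_bound:
  fixes a M :: real and c y v :: complex
  assumes a: "0 < a" "a \<le> 1" and c: "cmod c \<le> 1" and y: "cmod y \<le> 1" and v: "cmod v \<le> 1"
    and M: "\<And>t. 0 \<le> t \<Longrightarrow> t \<le> 1 \<Longrightarrow> 4 + (6*a-2)*t - (4+6*a+a\<^sup>2)*t\<^sup>2 \<le> M"
    and c2: "c2 = (1 - (cmod c)\<^sup>2) * y"
    and c3: "c3 = (1 - (cmod c)\<^sup>2) * ((1 - (cmod y)\<^sup>2) * v - cnj c * y\<^sup>2)"
  shows "cmod ((2+a\<^sup>2) * c^4 - 6*a*c\<^sup>2*c2 - 4*c2\<^sup>2 + 6*c*c3) \<le> M"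
proof -
  define x where "x = cmod c"
  define s where "s = x\<^sup>2"
  define t where "t = cmod y"
  define A where "A = (2+a\<^sup>2) * s\<^sup>2"
  define B where "B = 6*a * s*(1-s)"
  define K where "K = (1-s)*(4+2 * s)"
  define D where "D = 6*(1-s)*x"
  have x: "0 \<le> x" "x \<le> 1" using c by (auto simp: x_def)
  have s: "0 \<le> s" "s \<le> 1" using x by (auto simp: s_def power_le_one)
  have t: "0 \<le> t" "t \<le> 1" using y by (auto simp: t_def)
  have nonneg: "0 \<le> A" "0 \<le> B" "0 \<le> K" "0 \<le> D"
    using s x a by (auto simp: A_def B_def K_def D_def)
  have M4: "4 \<le> M" using M[of 0] by simp
  \<comment> \<open>Up to the factor \<open>\<eta>\<^sup>2\<close> and the argument of \<open>v\<close>, the functional only changes by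
    replacing \<open>c\<^sup>2\<close> with \<open>s\<close> and \<open>y\<close> with \<open>y/\<eta>\<close>.\<close>
  obtain \<eta> :: complex where \<eta>: "cmod \<eta> = 1" "c\<^sup>2 = s * \<eta>"
  proof (cases "c = 0")
    case True
    then show ?thesis using that[of 1] by (simp add: s_def x_def)
  next
    case False
    then show ?thesis using that[of "c\<^sup>2 / s"]
      by (simp add: s_def x_def norm_divide norm_power)
  qed
  have \<eta>0: "\<eta> \<noteq> 0" using \<eta> by auto
  obtain e :: complex where e: "cmod e = 1" "y = t * e * \<eta>"
  proof (cases "y = 0")
    case True
    then show ?thesis using that[of 1] by (simp add: t_def)
  next
    case False
    then show ?thesis using that[of "y / (t * \<eta>)"] \<eta> \<eta>0
      by (simp add: t_def norm_divide norm_mult)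
  qed
  have N: "cmod (A - B * e - K * e\<^sup>2) \<le> M"
    using e(1) M4 circle_quadratic_bound[OF a s _ _ M A_def B_def K_def] by (intro unit_circle_polynomial_bound) auto
  have cc: "c * cnj c = s" by (simp add: s_def x_def flip: complex_norm_square)
  have "(2+a\<^sup>2) * c^4 - 6*a*c\<^sup>2*c2 - 4*c2\<^sup>2 + 6*c*c3
     = \<eta>\<^sup>2 * ((1-t\<^sup>2) * A - t*(1-t) * (B*e) + t\<^sup>2 * (A - B * e - K * e\<^sup>2))
       + (1-t\<^sup>2) * (6*(1-s)*c * v)"
  proof -
    have c4: "c^4 = s\<^sup>2 * \<eta>\<^sup>2"
      using \<eta>(2) by (metis power_mult_distrib power2_eq_square power4_eq_xxxx mult.assoc of_real_power)
    have cc3: "6*c*c3 = 6*(1-s)*((1-t\<^sup>2)*(c * v) - (c * cnj c) * y\<^sup>2)"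
      by (simp add: c3 s_def x_def t_def algebra_simps)
    have c2': "c2 = (1-s) * y" by (simp add: c2 s_def x_def)
    show ?thesis
      unfolding cc3 c4 c2' cc \<eta>(2) e(2) A_def B_def K_def of_real_add of_real_mult
        of_real_diff of_real_power of_real_1 of_real_numeral
      by algebra
  qed
  also have "cmod \<dots> \<le> ((1-t\<^sup>2) * A + t*(1-t) * B + t\<^sup>2 * M) + (1-t\<^sup>2) * D"
  proof -
    have t2: "0 \<le> 1 - t\<^sup>2" using t by (simp add: power_le_one)
    have "cmod ((1-t\<^sup>2) * A - t*(1-t) * (B*e) + t\<^sup>2 * (A - B * e - K * e\<^sup>2))
       \<le> cmod ((1-t\<^sup>2) * A) + cmod (t*(1-t) * (B*e)) + cmod (t\<^sup>2 * (A - B * e - K * e\<^sup>2))"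
      by (meson norm_triangle_ineq norm_triangle_ineq4 order_trans add_right_mono)
    moreover have "cmod (complex_of_real ((1-t\<^sup>2) * A)) = (1-t\<^sup>2) * A"
      using t2 nonneg by (simp only: norm_of_real) simp
    moreover have "cmod (t*(1-t) * (B*e)) = t*(1-t) * B"
      using t nonneg by (simp only: norm_mult norm_of_real e) simp
    moreover have "cmod (t\<^sup>2 * (A - B * e - K * e\<^sup>2)) \<le> t\<^sup>2 * M"
      unfolding norm_mult norm_of_real using N by (intro mult_mono) auto
    moreover have "cmod ((1-t\<^sup>2) * (6*(1-s)*c * v)) \<le> (1-t\<^sup>2) * D"
    proof -
      have "cmod (complex_of_real (1-t\<^sup>2) * (complex_of_real (6*(1-s))*c * v)) = (1-t\<^sup>2) * (6*(1-s)*x*cmod v)"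
        using t2 s by (simp only: norm_mult norm_of_real x_def) simp
      also have "\<dots> \<le> (1-t\<^sup>2) * (6*(1-s)*x*1)"
        using t2 s x v by (intro mult_left_mono) auto
      finally show ?thesis by (simp add: D_def)
    qed
    ultimately show ?thesis
      by (intro order_trans[OF norm_triangle_ineq add_mono]) (auto simp: norm_mult norm_power \<eta>)
  qed
  also have "\<dots> \<le> M"
  proof -
    have "t*(1-t)*B \<le> (1-t\<^sup>2)/2*B"
    proof (rule mult_right_mono)
      have "(1-t\<^sup>2)/2 - t*(1-t) = (1-t)\<^sup>2/2" by (simp add: power2_eq_square field_simps)
      also have "0 \<le> \<dots>" by simp
      finally show "t*(1-t) \<le> (1-t\<^sup>2)/2" by simp
    qed (rule nonneg)
    moreover have "A + B/2 + D \<le> M"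
      using inner_part_bound[of a x] a x M4 by (simp add: A_def B_def D_def s_def)
    then have "(1-t\<^sup>2)*(A + B/2 + D) \<le> (1-t\<^sup>2)*M" using t by (intro mult_left_mono) (auto simp: power_le_one)
    ultimately show ?thesis by (simp add: algebra_simps)
  qed
  finally show ?thesis .
qed

section \<open>Strongly convex functions and Schwarz functions\<close>

text \<open>
  As \<open>\<alpha> \<le> 1\<close>, the sector lies in the right half-plane, so \<open>f\<close> is convex and the criteria for
  injectivity and covering apply with \<open>L = log f'\<close>.
\<close>

lemma strongly_convex_log_inverse:
  assumes "\<alpha> \<le> 1" and f: "f \<in> strongly_convex \<alpha>"
  shows "ball 0 (1/4) \<subseteq> f ` ball 0 1" and "\<exists>F. is_log_inverse f F"
proof -
  let ?B = "ball (0::complex) 1"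
  have f_hol: "f holomorphic_on ?B" and f0: "f 0 = 0" "deriv f 0 = 1"
    and f': "\<And>z. z \<in> ?B \<Longrightarrow> deriv f z \<noteq> 0"
    using f by (auto simp: strongly_convex_def class_A_def)
  have "deriv f holomorphic_on ?B" using f_hol by (intro holomorphic_intros) auto
  then obtain L where L: "L holomorphic_on ?B" "\<And>z. z \<in> ?B \<Longrightarrow> exp (L z) = deriv f z"
    using holomorphic_logarithm_exists[OF convex_ball open_ball, of "deriv f" 0 1 0] f' by auto
  have df: "(f has_field_derivative exp (L z)) (at z)" if "z \<in> ?B" for z
    using holomorphic_derivI[OF f_hol open_ball that] L(2)[OF that] by simp
  have dL: "deriv L z = deriv (deriv f) z / deriv f z" if z: "z \<in> ?B" for z
  proof -
    have "((\<lambda>z. exp (L z)) has_field_derivative exp (L z) * deriv L z) (at z)"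
      using z by (intro DERIV_exp[THEN DERIV_chain2] holomorphic_derivI[OF L(1)]) auto
    then have "(deriv f has_field_derivative exp (L z) * deriv L z) (at z)"
      by (rule has_field_derivative_transform_within_open[of _ _ _ ?B]) (use z L in auto)
    then have "deriv (deriv f) z = deriv f z * deriv L z" using L(2)[OF z] by (simp add: DERIV_imp_deriv)
    then show ?thesis using f'[OF z] by simp
  qed
  have convex: "0 < Re (1 + z * deriv L z)" if z: "z \<in> ?B" for z
  proof -
    define Q where "Q = 1 + z * deriv (deriv f) z / deriv f z"
    have "Q \<noteq> 0" "\<bar>Arg Q\<bar> < pi * \<alpha> / 2"
      using f z by (auto simp: strongly_convex_def Q_def)
    moreover have "pi * \<alpha> / 2 \<le> pi / 2" using \<open>\<alpha> \<le> 1\<close> by simp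
    ultimately have "\<bar>Arg Q\<bar> < pi / 2" by linarith
    then have "0 < Re Q" using Arg_Re_pos \<open>Q \<noteq> 0\<close> by blast
    then show ?thesis using dL[OF z] by (simp add: Q_def)
  qed
  have "exp (L 0) = 1" using L(2)[of 0] f0 by simp
  then have "Re (L 0) = 0" by (metis norm_exp_eq_Re norm_one exp_eq_one_iff)
  have inj: "inj_on f ?B"
    by (intro inj_on_ball_if_inj_on_circles f_hol f' convex_inj_circle[OF L(1) df convex]) auto
  show cover: "ball 0 (1/4) \<subseteq> f ` ?B"
  proof (rule ball_subset_image_if_deriv_bound[OF f_hol inj f0(1)])
    fix z assume "z \<in> ?B"
    then show "1/4 \<le> cmod (deriv f z)"
      using convex_deriv_lower_bound[OF L(1) \<open>Re (L 0) = 0\<close> convex] L(2) by metis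
  qed simp
  show "\<exists>F. is_log_inverse f F"
    by (rule is_log_inverse_exists[OF f_hol inj f0 cover])
qed

text \<open>
  The sector is the image of the right half-plane under the principal power \<open>\<alpha>\<close>; since
  \<open>\<alpha> \<le> 1\<close>, the values of \<open>1 + z f''/f'\<close> avoid the branch cut, and their principal power
  \<open>1/\<alpha>\<close> is holomorphic with positive real part.
\<close>

lemma strongly_convex_schwarz:
  assumes \<alpha>: "0 < \<alpha>" "\<alpha> \<le> 1" and f: "f \<in> strongly_convex \<alpha>"
  obtains \<omega> where "\<omega> holomorphic_on ball 0 1" "\<And>z. z \<in> ball 0 1 \<Longrightarrow> cmod (\<omega> z) < 1" "\<omega> 0 = 0"
    "\<And>z. z \<in> ball 0 1 \<Longrightarrow>
       1 + z * deriv (deriv f) z / deriv f z = ((1 + \<omega> z) / (1 - \<omega> z)) powr \<alpha>"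
proof -
  let ?B = "ball (0::complex) 1"
  define Q where "Q = (\<lambda>z. 1 + z * deriv (deriv f) z / deriv f z)"
  have f_hol: "f holomorphic_on ?B" and f': "\<And>z. z \<in> ?B \<Longrightarrow> deriv f z \<noteq> 0"
    and Q0: "\<And>z. z \<in> ?B \<Longrightarrow> Q z \<noteq> 0" and argQ: "\<And>z. z \<in> ?B \<Longrightarrow> \<bar>Arg (Q z)\<bar> < pi * \<alpha> / 2"
    using f by (auto simp: strongly_convex_def class_A_def Q_def)
  have "pi * \<alpha> / 2 \<le> pi / 2" using \<alpha> by simp
  have Re_Q: "0 < Re (Q z)" if "z \<in> ?B" for z
    using argQ[OF that] Q0[OF that] \<open>pi * \<alpha> / 2 \<le> pi / 2\<close> Arg_Re_pos[of "Q z"] by linarith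
  have "Q holomorphic_on ?B"
    unfolding Q_def using f_hol f' by (intro holomorphic_intros) auto
  define P where "P = (\<lambda>z. exp (Ln (Q z) / \<alpha>))"
  have P_hol: "P holomorphic_on ?B"
    unfolding P_def using \<open>Q holomorphic_on ?B\<close> Re_Q \<alpha>
    by (intro holomorphic_intros) (auto simp: complex_nonpos_Reals_iff not_le[symmetric])
  have im: "\<bar>Im (Ln (Q z) / \<alpha>)\<bar> < pi / 2" if "z \<in> ?B" for z
    using argQ[OF that] Q0[OF that] \<alpha> by (simp add: Arg_eq_Im_Ln field_simps abs_mult)
  have P_pos: "0 < Re (P z)" if "z \<in> ?B" for z
  proof -
    have "Im (Ln (Q z) / \<alpha>) < pi / 2" "- (pi / 2) < Im (Ln (Q z) / \<alpha>)"
      using im[OF that] by (simp_all only: abs_less_iff minus_less_iff)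
    then show ?thesis unfolding P_def Re_exp by (intro mult_pos_pos cos_gt_zero_pi exp_gt_zero)
  qed
  have "P 0 = 1" by (simp add: P_def Q_def)
  obtain \<omega> where \<omega>: "\<omega> holomorphic_on ?B" "\<And>z. z \<in> ?B \<Longrightarrow> cmod (\<omega> z) < 1" "\<omega> 0 = 0"
    "\<And>z. z \<in> ?B \<Longrightarrow> P z = (1 + \<omega> z) / (1 - \<omega> z)"
    using schwarz_of_halfplane[OF P_hol P_pos \<open>P 0 = 1\<close>] by blast
  show ?thesis
  proof (rule that[OF \<omega>(1-3)])
    fix z assume z: "z \<in> ?B"
    have "Ln (P z) = Ln (Q z) / \<alpha>"
      unfolding P_def using im[OF z] pi_gt_zero by (intro Ln_exp) linarith+
    then have "P z powr \<alpha> = Q z"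
      using Q0[OF z] \<alpha> by (simp add: powr_def P_def)
    then show "1 + z * deriv (deriv f) z / deriv f z = ((1 + \<omega> z) / (1 - \<omega> z)) powr \<alpha>"
      using \<omega>(4)[OF z] by (simp add: Q_def)
  qed
qed

text \<open>
  Integrating twice: with \<open>Q\<close> the prescribed value of \<open>1 + z f''/f'\<close>, first \<open>log f'\<close> is a
  primitive of \<open>(Q - 1)/z\<close>, then \<open>f\<close> is a primitive of \<open>f'\<close>.
\<close>

lemma strongly_convex_of_schwarz:
  assumes \<alpha>: "0 < \<alpha>" "\<alpha> \<le> 1"
    and \<omega>: "\<omega> holomorphic_on ball 0 1" "\<And>z. z \<in> ball 0 1 \<Longrightarrow> cmod (\<omega> z) < 1" "\<omega> 0 = 0"
  obtains f where "f \<in> strongly_convex \<alpha>"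
    "\<And>z. z \<in> ball 0 1 \<Longrightarrow>
       1 + z * deriv (deriv f) z / deriv f z = ((1 + \<omega> z) / (1 - \<omega> z)) powr \<alpha>"
proof -
  let ?B = "ball (0::complex) 1"
  define P where "P = (\<lambda>z. (1 + \<omega> z) / (1 - \<omega> z))"
  define Q where "Q = (\<lambda>z. P z powr \<alpha>)"
  have P_pos: "0 < Re (P z)" if "z \<in> ?B" for z
    unfolding P_def by (rule Re_cayley_pos[OF \<omega>(2)[OF that]])
  have P0: "P z \<noteq> 0" if "z \<in> ?B" for z using P_pos[OF that] by auto
  have "1 - \<omega> z \<noteq> 0" if "z \<in> ?B" for z using \<omega>(2)[OF that] by auto
  then have "P holomorphic_on ?B" unfolding P_def using \<omega>(1) by (intro holomorphic_intros) auto
  then have "(\<lambda>z. Q z - 1) holomorphic_on ?B"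
    unfolding Q_def using P_pos
    by (intro holomorphic_intros) (auto simp: complex_nonpos_Reals_iff not_le[symmetric])
  moreover have "Q 0 - 1 = 0" using \<omega>(3) by (simp add: Q_def P_def)
  ultimately obtain h where h: "h holomorphic_on ?B" "\<And>z. cmod z < 1 \<Longrightarrow> Q z - 1 = z * h z"
    using Schwarz3[of "\<lambda>z. Q z - 1" 1] by blast
  obtain L where L: "\<And>z. z \<in> ?B \<Longrightarrow> (L has_field_derivative h z) (at z within ?B)"
    using holomorphic_convex_primitive'[OF convex_ball open_ball h(1)] by blast
  have L': "(L has_field_derivative h z) (at z)" if "z \<in> ?B" for z
    using L[OF that] that by (simp add: at_within_open[of z ?B])
  have "(\<lambda>z. exp (L z - L 0)) holomorphic_on ?B"
    using L' by (intro holomorphic_intros) (meson holomorphic_on_open open_ball)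
  then obtain g where g: "\<And>z. z \<in> ?B \<Longrightarrow> (g has_field_derivative exp (L z - L 0)) (at z within ?B)"
    using holomorphic_convex_primitive'[OF convex_ball open_ball] by blast
  define f where "f = (\<lambda>z. g z - g 0)"
  have df: "(f has_field_derivative exp (L z - L 0)) (at z)" if "z \<in> ?B" for z
    using g[OF that] that unfolding f_def by (auto simp: at_within_open[of z ?B] intro!: derivative_eq_intros)
  then have f': "deriv f z = exp (L z - L 0)" if "z \<in> ?B" for z
    using that by (simp add: DERIV_imp_deriv)
  have f'': "deriv (deriv f) z = exp (L z - L 0) * h z" if z: "z \<in> ?B" for z
  proof -
    have "((\<lambda>z. exp (L z - L 0)) has_field_derivative exp (L z - L 0) * h z) (at z)"
      using L'[OF z] by (auto intro!: derivative_eq_intros)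
    then have "(deriv f has_field_derivative exp (L z - L 0) * h z) (at z)"
      by (rule has_field_derivative_transform_within_open[of _ _ _ ?B]) (use z f' in auto)
    then show ?thesis by (rule DERIV_imp_deriv)
  qed
  have eq: "1 + z * deriv (deriv f) z / deriv f z = Q z" if z: "z \<in> ?B" for z
    using f'[OF z] f''[OF z] h(2)[of z] z by (simp add: algebra_simps)
  have "f \<in> class_A"
  proof -
    have "f holomorphic_on ?B" using df by (meson holomorphic_on_open open_ball)
    moreover have "f 0 = 0" by (simp add: f_def)
    ultimately show ?thesis using f'[of 0] by (simp add: class_A_def)
  qed
  moreover have "\<bar>Arg (Q z)\<bar> < pi * \<alpha> / 2" if z: "z \<in> ?B" for z
  proof -
    have "\<bar>Arg (P z)\<bar> < pi/2" using P_pos[OF z] Arg_Re_pos[of "P z"] by linarith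
    then have *: "\<bar>Im (\<alpha> * Ln (P z))\<bar> < pi * \<alpha> / 2" using \<alpha> P0[OF z] by (simp add: Arg_eq_Im_Ln abs_mult)
    moreover have "pi * \<alpha> / 2 \<le> pi / 2" using \<alpha> by simp
    ultimately have "Ln (Q z) = \<alpha> * Ln (P z)"
      using P0[OF z] pi_gt_zero unfolding Q_def powr_def by (simp only: if_False, intro Ln_exp) linarith+
    then show ?thesis using * P0[OF z] by (simp add: Arg_eq_Im_Ln Q_def)
  qed
  moreover have "Q z \<noteq> 0" if "z \<in> ?B" for z using P0[OF that] by (simp add: Q_def)
  ultimately have "f \<in> strongly_convex \<alpha>"
    unfolding strongly_convex_def using eq f' by auto
  then show ?thesis using that eq by (simp add: Q_def P_def)
qed

text \<open>
  The right side is the maximum over \<open>t \<ge> 0\<close>: for \<open>a \<le> 1/3\<close> the quadratic decreases, otherwise its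
  vertex is at \<open>t = (3a - 1)/(4 + 6a + a\<^sup>2)\<close>.
\<close>

lemma hankel_bound_quadratic:
  fixes a t :: real
  assumes a: "0 < a" "a \<le> 1" and t: "0 \<le> t"
  shows "4 + (6*a-2)*t - (4+6*a+a\<^sup>2)*t\<^sup>2 \<le>
    (if a \<le> 1/3 then 4 else (17 + 18*a + 13*a\<^sup>2) / (4 + 6*a + a\<^sup>2))"
proof (cases "a \<le> 1/3")
  case True
  have "(6*a-2)*t \<le> 0" using True t by (intro mult_nonpos_nonneg) auto
  moreover have "0 \<le> (4+6*a+a\<^sup>2)*t\<^sup>2" using a by simp
  ultimately show ?thesis using True by simp
next
  case False
  have pos: "0 < 4 + 6*a + a\<^sup>2" using a by (simp add: add_pos_nonneg)
  have "(4 + (6*a-2)*t - (4+6*a+a\<^sup>2)*t\<^sup>2) * (4 + 6*a + a\<^sup>2)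
    = (17 + 18*a + 13*a\<^sup>2) - ((4 + 6*a + a\<^sup>2) * t - (3*a-1))\<^sup>2" by algebra
  then have "(4 + (6*a-2)*t - (4+6*a+a\<^sup>2)*t\<^sup>2) * (4 + 6*a + a\<^sup>2) \<le> 17 + 18*a + 13*a\<^sup>2"
    by simp
  then show ?thesis using False pos by (simp add: pos_le_divide_eq)
qed

text \<open>
  The Schur parameters are \<open>c\<close> and \<open>y = 1\<close>. The Taylor coefficients are read off from
  \<open>\<omega>(z) (1 + c z) = z (z + c)\<close>.
\<close>

lemma extremal_schwarz:
  fixes c :: real and \<omega> :: "complex \<Rightarrow> complex"
  assumes c: "0 \<le> c" "c < 1" and \<omega>_def: "\<omega> = (\<lambda>z::complex. z * (z + c) / (1 + c * z))"
  shows "\<omega> holomorphic_on ball 0 1" and "\<And>z. z \<in> ball 0 1 \<Longrightarrow> cmod (\<omega> z) < 1" and "\<omega> 0 = 0"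
    and "fps_nth (fps_expansion \<omega> 0) 1 = c" and "fps_nth (fps_expansion \<omega> 0) 2 = 1 - c\<^sup>2"
    and "fps_nth (fps_expansion \<omega> 0) 3 = - c * (1 - c\<^sup>2)"
proof -
  have ne: "1 + c * z \<noteq> 0" if "z \<in> ball 0 1" for z :: complex
  proof
    assume "1 + c * z = 0"
    then have "cmod (c * z) = 1" by (metis add_eq_0_iff norm_minus_cancel norm_one)
    moreover have "c * cmod z \<le> c * 1" using that c by (intro mult_left_mono) auto
    ultimately show False using c by (simp add: norm_mult)
  qed
  show hol: "\<omega> holomorphic_on ball 0 1"
    unfolding \<omega>_def using ne by (intro holomorphic_intros) auto
  show "\<omega> 0 = 0" by (simp add: \<omega>_def)
  show "cmod (\<omega> z) < 1" if z: "z \<in> ball 0 1" for z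
  proof -
    have "cmod (Moebius_function 0 (- c) z) < 1"
      using z c by (intro Moebius_function_norm_lt_1) auto
    then have "cmod ((z + c) / (1 + c * z)) < 1" by (simp add: Moebius_function_simple)
    then have "cmod z * cmod ((z + c) / (1 + c * z)) \<le> cmod z * 1"
      by (intro mult_left_mono) auto
    moreover have "cmod (\<omega> z) = cmod z * cmod ((z + c) / (1 + c * z))"
      by (simp add: \<omega>_def norm_mult norm_divide)
    ultimately show ?thesis using z by simp
  qed
  define W where "W = fps_expansion \<omega> 0"
  have exW: "\<omega> has_fps_expansion W" unfolding W_def using hol by (rule has_fps_expansion_ball) simp
  have W: "W * (1 + fps_const (of_real c) * fps_X) = fps_X * (fps_X + fps_const (of_real c))"
  proof (rule has_fps_expansion_eqI[where r = 1])
    show "(\<lambda>z. \<omega> z * (1 + of_real c * z)) has_fps_expansion W * (1 + fps_const (of_real c) * fps_X)"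
      by (intro fps_expansion_intros exW)
    show "(\<lambda>z::complex. z * (z + of_real c)) has_fps_expansion fps_X * (fps_X + fps_const (of_real c))"
      by (intro fps_expansion_intros)
    fix z :: complex assume "z \<in> ball 0 1"
    then show "\<omega> z * (1 + of_real c * z) = z * (z + of_real c)" using ne[of z] by (simp add: \<omega>_def)
  qed simp
  have W0: "fps_nth W 0 = 0" using has_fps_expansion_imp_0_eq_fps_nth_0[OF exW] by (simp add: \<omega>_def)
  have n: "(3::nat) = Suc (Suc (Suc 0))" "(2::nat) = Suc (Suc 0)" "(1::nat) = Suc 0" by simp_all
  have "W + fps_const (of_real c) * (fps_X * W) = fps_X * fps_X + fps_const (of_real c) * fps_X"
    using W by (simp add: algebra_simps)
  then have "fps_nth (W + fps_const (of_real c) * (fps_X * W)) k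
      = fps_nth (fps_X * fps_X + fps_const (of_real c) * fps_X) k" for k
    by (simp only:)
  from this[of 1] this[of 2] this[of 3]
  have W1: "fps_nth W 1 = c" and W2: "fps_nth W 2 + c * fps_nth W 1 = 1" and W3: "fps_nth W 3 + c * fps_nth W 2 = 0"
    by (simp_all add: W0 n)
  show "fps_nth (fps_expansion \<omega> 0) 1 = c" using W1 by (simp add: W_def)
  show w2: "fps_nth (fps_expansion \<omega> 0) 2 = 1 - c\<^sup>2"
    using W1 W2 by (simp add: W_def power2_eq_square eq_diff_eq)
  show "fps_nth (fps_expansion \<omega> 0) 3 = - c * (1 - c\<^sup>2)"
    using W3 w2 by (simp add: W_def eq_neg_iff_add_eq_0)
qed

section \<open>The sharp bound\<close>

theorem theorem3p1:
  fixes \<alpha> :: real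
  assumes "0 < \<alpha>" and "\<alpha> \<le> 1"
  shows "(\<forall>f\<in>strongly_convex \<alpha>. norm (hankel_2_1 (log_inverse_coeff f)) \<le>
           (if \<alpha> \<le> 1/3 then \<alpha>\<^sup>2 / 36
            else \<alpha>\<^sup>2 * (17 + 18 * \<alpha> + 13 * \<alpha>\<^sup>2) / (144 * (4 + 6 * \<alpha> + \<alpha>\<^sup>2)))) \<and>
         (\<exists>f\<in>strongly_convex \<alpha>. norm (hankel_2_1 (log_inverse_coeff f)) =
           (if \<alpha> \<le> 1/3 then \<alpha>\<^sup>2 / 36
            else \<alpha>\<^sup>2 * (17 + 18 * \<alpha> + 13 * \<alpha>\<^sup>2) / (144 * (4 + 6 * \<alpha> + \<alpha>\<^sup>2))))"
proof -
  define M where "M = (if \<alpha> \<le> 1/3 then 4 else (17 + 18*\<alpha> + 13*\<alpha>\<^sup>2) / (4 + 6*\<alpha> + \<alpha>\<^sup>2))"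
  have bound_eq: "(if \<alpha> \<le> 1/3 then \<alpha>\<^sup>2 / 36
      else \<alpha>\<^sup>2 * (17 + 18 * \<alpha> + 13 * \<alpha>\<^sup>2) / (144 * (4 + 6 * \<alpha> + \<alpha>\<^sup>2))) = \<alpha>\<^sup>2 / 144 * M"
  proof (cases "\<alpha> \<le> 1/3")
    case False
    then show ?thesis by (simp only: M_def if_False times_divide_times_eq)
  qed (simp add: M_def)
  define \<Phi> :: "complex \<Rightarrow> complex \<Rightarrow> complex \<Rightarrow> complex"
    where "\<Phi> = (\<lambda>(c1::complex) (c2::complex) (c3::complex). (2+\<alpha>\<^sup>2) * c1 ^ 4 - 6 * \<alpha> * c1\<^sup>2 * c2 - 4 * c2\<^sup>2 + 6 * c1 * c3)"
  have formula: "cmod (hankel_2_1 (log_inverse_coeff f)) = \<alpha>\<^sup>2 / 144 * cmod (\<Phi> (c 1) (c 2) (c 3))"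
    if f: "f \<in> strongly_convex \<alpha>"
      and \<omega>: "\<omega> holomorphic_on ball 0 1" "\<And>z. z \<in> ball 0 1 \<Longrightarrow> cmod (\<omega> z) < 1" "\<omega> 0 = 0"
        "\<And>z. z \<in> ball 0 1 \<Longrightarrow>
           1 + z * deriv (deriv f) z / deriv f z = ((1 + \<omega> z) / (1 - \<omega> z)) powr \<alpha>"
      and c: "c = fps_nth (fps_expansion \<omega> 0)"
    for f \<omega> :: "complex \<Rightarrow> complex" and c :: "nat \<Rightarrow> complex"
  proof -
    have "hankel_2_1 (log_inverse_coeff f) = \<alpha>\<^sup>2 / 144 * \<Phi> (c 1) (c 2) (c 3)"
      unfolding \<Phi>_def c using f
      by (intro hankel_schwarz_coeffs \<omega> strongly_convex_log_inverse[OF assms(2) f])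
        (auto simp: strongly_convex_def class_A_def)
    then show ?thesis by (simp only: norm_mult norm_of_real) simp
  qed
  show ?thesis unfolding bound_eq
  proof (intro conjI ballI)
    fix f assume f: "f \<in> strongly_convex \<alpha>"
    obtain \<omega> where \<omega>: "\<omega> holomorphic_on ball 0 1" "\<And>z. z \<in> ball 0 1 \<Longrightarrow> cmod (\<omega> z) < 1" "\<omega> 0 = 0"
        "\<And>z. z \<in> ball 0 1 \<Longrightarrow>
           1 + z * deriv (deriv f) z / deriv f z = ((1 + \<omega> z) / (1 - \<omega> z)) powr \<alpha>"
      using strongly_convex_schwarz[OF assms f] by blast
    define c where "c = fps_nth (fps_expansion \<omega> 0)"
    obtain y v :: complex where yv: "cmod (c 1) \<le> 1" "cmod y \<le> 1" "cmod v \<le> 1"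
      "c 2 = (1 - (cmod (c 1))\<^sup>2) * y"
      "c 3 = (1 - (cmod (c 1))\<^sup>2) * ((1 - (cmod y)\<^sup>2) * v - cnj (c 1) * y\<^sup>2)"
      using schur_parameters[OF \<omega>(1) less_imp_le[OF \<omega>(2)] \<omega>(3)] unfolding c_def by blast
    have "cmod (\<Phi> (c 1) (c 2) (c 3)) \<le> M"
      unfolding \<Phi>_def
    proof (rule schur_functional_bound[OF assms yv(1-3) _ yv(4,5)])
      show "4 + (6*\<alpha>-2)*t - (4+6*\<alpha>+\<alpha>\<^sup>2)*t\<^sup>2 \<le> M" if "0 \<le> t" for t
        unfolding M_def by (rule hankel_bound_quadratic[OF assms that])
    qed
    moreover have "cmod (hankel_2_1 (log_inverse_coeff f)) = \<alpha>\<^sup>2 / 144 * cmod (\<Phi> (c 1) (c 2) (c 3))"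
      by (rule formula[OF f \<omega> c_def])
    ultimately show "cmod (hankel_2_1 (log_inverse_coeff f)) \<le> \<alpha>\<^sup>2 / 144 * M"
      by (simp add: mult_left_mono)
  next
    \<comment> \<open>The point where the quadratic in \<open>hankel_bound_quadratic\<close> attains its maximum.\<close>
    define s where "s = (if \<alpha> \<le> 1/3 then 0 else (3*\<alpha>-1) / (4 + 6*\<alpha> + \<alpha>\<^sup>2))"
    have pos: "0 < 4 + 6*\<alpha> + \<alpha>\<^sup>2" using assms by (simp add: add_pos_nonneg)
    have s: "0 \<le> s" "s < 1"
      using assms pos by (auto simp: s_def divide_less_eq intro!: divide_nonneg_pos add_nonneg_nonneg) (smt (verit) zero_le_power2)
    have s_max: "4 + (6*\<alpha>-2) * s - (4+6*\<alpha>+\<alpha>\<^sup>2) * s\<^sup>2 = M"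
    proof (cases "\<alpha> \<le> 1/3")
      case False
      then have "s * (4 + 6*\<alpha> + \<alpha>\<^sup>2) = 3*\<alpha>-1" using pos by (simp add: s_def)
      then have "(4 + (6*\<alpha>-2) * s - (4+6*\<alpha>+\<alpha>\<^sup>2) * s\<^sup>2) * (4 + 6*\<alpha> + \<alpha>\<^sup>2) = 17 + 18*\<alpha> + 13*\<alpha>\<^sup>2" by algebra
      then show ?thesis using False pos by (simp add: M_def eq_divide_eq)
    qed (simp add: s_def M_def)
    define c where "c = sqrt s"
    have c: "0 \<le> c" "c < 1" "c\<^sup>2 = s" using s by (auto simp: c_def)
    define \<omega> where "\<omega> = (\<lambda>z::complex. z * (z + c) / (1 + c * z))"
    note \<omega> = extremal_schwarz[OF c(1,2) \<omega>_def]
    obtain f where f: "f \<in> strongly_convex \<alpha>"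
      "\<And>z. z \<in> ball 0 1 \<Longrightarrow>
         1 + z * deriv (deriv f) z / deriv f z = ((1 + \<omega> z) / (1 - \<omega> z)) powr \<alpha>"
      using strongly_convex_of_schwarz[OF assms \<omega>(1-3)] by blast
    have "(2+\<alpha>\<^sup>2) * c^4 - 6*\<alpha>*c\<^sup>2*(1-c\<^sup>2) - 4*(1-c\<^sup>2)\<^sup>2 + 6*c*(- c*(1-c\<^sup>2)) = - M"
      unfolding s_max[symmetric] c(3)[symmetric] by algebra
    from arg_cong[OF this, of complex_of_real]
    have \<Phi>: "\<Phi> c (1 - c\<^sup>2) (- c * (1 - c\<^sup>2)) = complex_of_real (- M)"
      unfolding \<Phi>_def by simp
    have "0 \<le> M" using assms pos by (auto simp: M_def intro!: divide_nonneg_pos add_nonneg_nonneg)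
    have "cmod (hankel_2_1 (log_inverse_coeff f)) = \<alpha>\<^sup>2 / 144 * cmod (\<Phi> c (1 - c\<^sup>2) (- c * (1 - c\<^sup>2)))"
      unfolding \<omega>(4-6)[symmetric] by (rule formula[OF f(1) \<omega>(1-3) f(2) refl])
    also have "\<dots> = \<alpha>\<^sup>2 / 144 * M"
      unfolding \<Phi> norm_of_real using \<open>0 \<le> M\<close> by simp
    finally have "cmod (hankel_2_1 (log_inverse_coeff f)) = \<alpha>\<^sup>2 / 144 * M" .
    then show "\<exists>f\<in>strongly_convex \<alpha>. cmod (hankel_2_1 (log_inverse_coeff f)) = \<alpha>\<^sup>2 / 144 * M"
      using f(1) by blast
  qed
qed

end
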